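(* Let $A(x,y)=A_0+\sum_{i=1}^dx_iA_i+\sum_{j=1}^my_jA'_j\in\mathcal{S}^k[x,y]$ be a strictly feasible linear pencil such that $\pi(S_A)$ is bounded. For every $l\in\mathbb{N}$ (positive integer), the quadratic module $\mathcal{M}^l(\pi A)$ is Archimedean and contains every matrix polynomial $F\in\mathcal{S}^l[x]$ that is positive definite on $\operatorname{cl}\pi(S_A)$.
   Context: $\mathcal{S}^k$ is the space of real symmetric $k\times k$ matrices and $\mathcal{S}^k[x]$ the space of symmetric $k\times k$ matrices with entries in $\mathbb{R}[x]$, $x=(x_1,\dots,x_d)$, $y=(y_1,\dots,y_m)$. A linear pencil is a matrix polynomial of degree at most one with symmetric coefficients; it is strictly feasible if $A(x,y)\succ0$ for some $(x,y)$. $\pi(S_A)=\{x\in\mathbb{R}^d\mid\exists y\in\mathbb{R}^m:\ A(x,y)\succeq0\}$. $\operatorname{cl}$ denotes closure. For a symmetric matrix $M=(M_{ij})_{i,j=1}^l$ of size $kl\times kl$ with $k\times k$ blocks $M_{ij}$ (possibly polynomial) and a symmetric $k\times k$ matrix $N$ (possibly polynomial), the $l$th scalar product is the $l\times l$ matrix $\langle M,N\rangle_l:=(\langle M_{ij},N\rangle)_{i,j=1}^l$, where $\langle\cdot,\cdot\rangle$ is the Euclidean (trace) inner product. $\Sigma^k[x]\subseteq\mathcal{S}^k[x]$ is the set of sum of squares matrix polynomials, i.e. those of the form $U(x)U(x)^T$ with $U(x)\in\mathbb{R}[x]^{k\times r}$ for some $r$. Define $$\mathcal{M}^l(\pi A)=\left\{S_0+\langle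 S,A(x,0)\rangle_l\ \middle|\ \langle S,A'_i\rangle_l=0\ \forall i\in\{1,\dots,m\},\ S_0\in\Sigma^l[x],\ S\in\Sigma^{kl}[x]\right\}\subseteq\mathcal{S}^l[x].$$ It is Archimedean if $(N-x^Tx)I_l\in\mathcal{M}^l(\pi A)$ for some positive integer $N$. *)

theory Defs
  imports "HOL-Analysis.Analysis" "HOL-Library.Poly_Mapping"
begin

(* Real polynomials in the variables x_i, i ranging over the finite index type 'd:
   finitely supported maps from exponent vectors to coefficients. *)
type_synonym 'd rpoly = "('d \<Rightarrow>\<^sub>0 nat) \<Rightarrow>\<^sub>0 real"

definition pconst :: "real \<Rightarrow> 'd rpoly"
  where "pconst c = Poly_Mapping.single 0 c"

definition pvar :: "'d \<Rightarrow> 'd rpoly"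
  where "pvar i = Poly_Mapping.single (Poly_Mapping.single i 1) 1"

definition peval :: "'d::finite rpoly \<Rightarrow> real^'d \<Rightarrow> real"
  where "peval p x =
    (\<Sum>e\<in>Poly_Mapping.keys p. Poly_Mapping.lookup p e * (\<Prod>i\<in>UNIV. (x $ i) ^ Poly_Mapping.lookup e i))"

definition mat_peval :: "'d::finite rpoly^'n^'n \<Rightarrow> real^'d \<Rightarrow> real^'n^'n"
  where "mat_peval F x = (\<chi> a b. peval (F $ a $ b) x)"

definition mat_pconst :: "real^'n^'n \<Rightarrow> 'd rpoly^'n^'n"
  where "mat_pconst B = (\<chi> a b. pconst (B $ a $ b))"

definition sym_mat :: "'a^'n^'n \<Rightarrow> bool"
  where "sym_mat B \<longleftrightarrow> transpose B = B"

definition pos_semidef :: "real^'n^'n \<Rightarrow> bool"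
  where "pos_semidef B \<longleftrightarrow> sym_mat B \<and> (\<forall>v. 0 \<le> v \<bullet> (B *v v))"

definition pos_def :: "real^'n^'n \<Rightarrow> bool"
  where "pos_def B \<longleftrightarrow> sym_mat B \<and> (\<forall>v. v \<noteq> 0 \<longrightarrow> 0 < v \<bullet> (B *v v))"

(* The value A(x,y) of the pencil with coefficients A0, A i, A' j.  The number m of
   y-variables may be 0, so y is a sequence of which only y 1, ..., y m matter. *)
definition pencil ::
  "nat \<Rightarrow> real^'k^'k \<Rightarrow> ('d::finite \<Rightarrow> real^'k^'k) \<Rightarrow> (nat \<Rightarrow> real^'k^'k)
    \<Rightarrow> real^'d \<Rightarrow> (nat \<Rightarrow> real) \<Rightarrow> real^'k^'k"
  where "pencil m A0 A A' x y =
    A0 + (\<Sum>i\<in>UNIV. (x $ i) *\<^sub>R A i) + (\<Sum>j=1..m. y j *\<^sub>R A' j)"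

definition strictly_feasible ::
  "nat \<Rightarrow> real^'k^'k \<Rightarrow> ('d::finite \<Rightarrow> real^'k^'k) \<Rightarrow> (nat \<Rightarrow> real^'k^'k) \<Rightarrow> bool"
  where "strictly_feasible m A0 A A' \<longleftrightarrow> (\<exists>x y. pos_def (pencil m A0 A A' x y))"

definition proj_spectrahedron ::
  "nat \<Rightarrow> real^'k^'k \<Rightarrow> ('d::finite \<Rightarrow> real^'k^'k) \<Rightarrow> (nat \<Rightarrow> real^'k^'k) \<Rightarrow> (real^'d) set"
  where "proj_spectrahedron m A0 A A' = {x. \<exists>y. pos_semidef (pencil m A0 A A' x y)}"

(* A(x,0) as a matrix polynomial in x *)
definition pencil_x0 ::
  "real^'k^'k \<Rightarrow> ('d::finite \<Rightarrow> real^'k^'k) \<Rightarrow> 'd rpoly^'k^'k"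
  where "pencil_x0 A0 A =
    (\<chi> a b. pconst (A0 $ a $ b) + (\<Sum>i\<in>UNIV. pvar i * pconst (A i $ a $ b)))"

definition trace_inner :: "'a::comm_semiring_1^'k^'k \<Rightarrow> 'a^'k^'k \<Rightarrow> 'a"
  where "trace_inner M N = (\<Sum>a\<in>UNIV. \<Sum>b\<in>UNIV. M $ a $ b * N $ a $ b)"

(* A kl x kl matrix is indexed by pairs (block index, index within the block). *)
definition block :: "'a^('l::finite \<times> 'k::finite)^('l \<times> 'k) \<Rightarrow> 'l \<Rightarrow> 'l \<Rightarrow> 'a^'k^'k"
  where "block M i j = (\<chi> a b. M $ (i, a) $ (j, b))"

definition block_inner ::
  "'a::comm_semiring_1^('l::finite \<times> 'k::finite)^('l \<times> 'k) \<Rightarrow> 'a^'k^'k \<Rightarrow> 'a^'l^'l"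
  where "block_inner M N = (\<chi> i j. trace_inner (block M i j) N)"

(* The entries of U U^T for a matrix U with r columns; r is existentially quantified and
   so cannot be a type. *)
definition sos_mats :: "('d::finite rpoly^'n^'n) set"
  where "sos_mats =
    {S. \<exists>(r::nat) (U :: 'n \<Rightarrow> nat \<Rightarrow> 'd rpoly). S = (\<chi> a b. \<Sum>c<r. U a c * U b c)}"

definition quad_module ::
  "nat \<Rightarrow> real^'k^'k \<Rightarrow> ('d::finite \<Rightarrow> real^'k^'k) \<Rightarrow> (nat \<Rightarrow> real^'k^'k)
    \<Rightarrow> ('d rpoly^'l^'l) set"
  where "quad_module m A0 A A' =
    {S0 + block_inner S (pencil_x0 A0 A) | S0 (S :: 'd rpoly^('l \<times> 'k)^('l \<times> 'k)).
       (\<forall>j\<in>{1..m}. block_inner S (mat_pconst (A' j)) = 0) \<and> S0 \<in> sos_mats \<and> S \<in> sos_mats}"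

definition archimedean :: "('d::finite rpoly^'l^'l) set \<Rightarrow> bool"
  where "archimedean Q \<longleftrightarrow>
    (\<exists>N::nat. 0 < N \<and> mat (of_nat N - (\<Sum>i\<in>UNIV. pvar i * pvar i)) \<in> Q)"

end

theory Submission imports Defs begin

text \<open>
  Write \<open>K\<close> for the projected spectrahedron. Everything rests on one fact about affine functions:
  if \<open>f\<close> is affine and nonnegative on \<open>K\<close>, then \<open>f = c0 + \<langle>S, A(x,0)\<rangle>\<close> with \<open>c0 \<ge> 0\<close>, a constant
  \<open>S \<succeq> 0\<close> and \<open>\<langle>S, A'_j\<rangle> = 0\<close> for all \<open>j\<close> (lemma \<open>nonneg_affine_certificate\<close>). To see it, separate the
  matrices \<open>A(x,y)\<close> with \<open>f x < 0\<close> from the positive semidefinite cone. The separating functional is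
  a positive semidefinite \<open>S\<close>, and it annihilates the \<open>A'_j\<close> because \<open>y\<close> is unrestricted. The affine
  function \<open>\<langle>S, A(x,0)\<rangle>\<close> is nonpositive wherever \<open>f\<close> is negative, and strict feasibility makes it
  positive somewhere, so a nonconstant \<open>f\<close> is a positive multiple of it plus a constant \<open>c0 \<ge> 0\<close>.

  Tensoring \<open>S\<close> with \<open>w w^T\<close> for a polynomial vector \<open>w\<close> shows \<open>f w w^T \<in> M^l\<close>. The polynomials \<open>p\<close>
  with \<open>p w w^T \<in> M^l\<close> for all \<open>w\<close> form a scalar quadratic module that contains every affine
  function nonnegative on \<open>K\<close>, and the rest of the argument uses only this (locale
  \<open>affine_matrix_module\<close>). As \<open>K\<close> is bounded, \<open>n \<plusminus> x_i\<close> is in it for large \<open>n\<close>, hence so is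
  \<open>n^2 - x_i^2\<close>, and \<open>M^l\<close> is Archimedean.

  Now let \<open>F\<close> be positive definite on the closure of \<open>K\<close>, and let \<open>g = C - x^T x\<close> be a ball polynomial
  in the scalar module. The preorder generated by the single polynomial \<open>g\<close> stays inside the scalar
  module. It contains \<open>R \<plusminus> x_i\<close> for \<open>R = C\<close> and, being closed under products, all Bernstein basis
  polynomials of the cube \<open>[-R,R]^d\<close>. Two steps remain.

  \<^item> If \<open>F\<close> is positive definite on the whole cube, its Bernstein coefficients of high degree are close
    to its values at the grid points, so they are positive semidefinite, and the Bernstein
    expansion puts \<open>F\<close> into \<open>M^l\<close> (\<open>mem_if_pos_on_cube\<close>).

  \<^item> In general, compactness gives finitely many affine functions that are nonnegative on \<open>K\<close>, at most
    \<open>1\<close> on the cube, and such that \<open>F\<close> is positive definite at each point of the cube where they are all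
    nonnegative. They are removed one at a time: subtracting \<open>\<mu> q (1 - q)^(2k) I\<close>, which lies in
    \<open>M^l\<close>, from \<open>F\<close> for suitable \<open>\<mu>\<close> and \<open>k\<close> makes positivity independent of the constraint
    \<open>q \<ge> 0\<close> (\<open>penalty_makes_positive\<close>, \<open>mem_if_pos_on_polyhedron\<close>).
\<close>

section \<open>Polynomials and their values\<close>

lemma pconst_simps:
  "pconst (a + b) = pconst a + pconst b" "pconst (a - b) = pconst a - pconst b"
  "pconst (a * b) = pconst a * pconst b" "pconst 0 = 0" "pconst 1 = 1"
  "pconst (- a) = - pconst a"
  by (simp_all add: pconst_def single_add single_diff single_uminus mult_single)

lemma pconst_sum: "pconst (\<Sum>a\<in>A. f a) = (\<Sum>a\<in>A. pconst (f a))"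
  by (induction A rule: infinite_finite_induct) (simp_all add: pconst_simps)

lemma pconst_prod: "pconst (\<Prod>a\<in>A. f a) = (\<Prod>a\<in>A. pconst (f a))"
  by (induction A rule: infinite_finite_induct) (simp_all add: pconst_simps)

lemma pconst_power: "pconst (a ^ n) = pconst a ^ n"
  by (induction n) (simp_all add: pconst_simps)

lemma pconst_of_nat: "pconst (of_nat n) = of_nat n"
  by (induction n) (simp_all add: pconst_simps)

text \<open>
  Polynomials are stored as finitely supported maps, while the Bernstein expansion works in the
  polynomial ring; this identity is the bridge between the two.
\<close>

lemma single_eq_monomial:
  "Poly_Mapping.single e c = pconst c * (\<Prod>i\<in>UNIV. pvar i ^ Poly_Mapping.lookup e i)"
  for e :: "'d::finite \<Rightarrow>\<^sub>0 nat"
proof -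
  have power: "pvar i ^ n = Poly_Mapping.single (Poly_Mapping.single i n) 1" for i :: 'd and n
    by (induction n) (simp_all add: pvar_def mult_single single_add[symmetric])
  have prod: "(\<Prod>i\<in>I. Poly_Mapping.single (f i) 1) = Poly_Mapping.single (sum f I) (1::real)"
    if "finite I" for f :: "'d \<Rightarrow> 'd \<Rightarrow>\<^sub>0 nat" and I
    using that by (induction I) (simp_all add: mult_single)
  have "(\<Sum>i\<in>UNIV. Poly_Mapping.single i (Poly_Mapping.lookup e i)) = e"
    by (rule poly_mapping_eqI) (simp add: lookup_sum lookup_single when_def)
  then show ?thesis
    by (simp add: power prod pconst_def mult_single)
qed

lemma rpoly_eq_sum_singles:
  "p = (\<Sum>e\<in>Poly_Mapping.keys p. Poly_Mapping.single e (Poly_Mapping.lookup p e))"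
  by (rule poly_mapping_eqI)
     (auto simp: lookup_sum lookup_single when_def in_keys_iff)

lemma peval_superset:
  assumes "finite E" "Poly_Mapping.keys p \<subseteq> E"
  shows "peval p x =
    (\<Sum>e\<in>E. Poly_Mapping.lookup p e * (\<Prod>i\<in>UNIV. (x $ i) ^ Poly_Mapping.lookup e i))"
  unfolding peval_def using assms by (intro sum.mono_neutral_left) (auto simp: in_keys_iff)

lemma peval_single:
  "peval (Poly_Mapping.single e c) x = c * (\<Prod>i\<in>UNIV. (x $ i) ^ Poly_Mapping.lookup e i)"
  by (subst peval_superset[of "{e}"]) auto

lemma peval_add: "peval (p + q) x = peval p x + peval q x"
proof -
  let ?E = "Poly_Mapping.keys p \<union> Poly_Mapping.keys q"
  have "peval r x = (\<Sum>e\<in>?E. Poly_Mapping.lookup r e * (\<Prod>i\<in>UNIV. (x $ i) ^ Poly_Mapping.lookup e i))"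
    if "Poly_Mapping.keys r \<subseteq> ?E" for r
    using that by (intro peval_superset) auto
  then show ?thesis
    using Poly_Mapping.keys_add[of p q] by (simp add: lookup_add distrib_right sum.distrib)
qed

lemma peval_pconst: "peval (pconst c) x = c"
  by (simp add: pconst_def peval_single)

lemma peval_zero: "peval 0 x = 0"
  by (simp add: peval_def)

lemma peval_one: "peval 1 x = 1"
  using peval_pconst[of 1 x] by (simp add: pconst_simps)

lemma peval_pvar: "peval (pvar i) x = x $ i"
proof -
  have "(\<Prod>j\<in>UNIV. (x $ j) ^ Poly_Mapping.lookup (Poly_Mapping.single i (1::nat)) j)
      = (\<Prod>j\<in>UNIV. if j = i then x $ j else 1)"
    by (intro prod.cong) (auto simp: lookup_single when_def)
  then show ?thesis
    by (simp add: pvar_def peval_single)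
qed

lemma peval_sum: "peval (\<Sum>a\<in>A. f a) x = (\<Sum>a\<in>A. peval (f a) x)"
  by (induction A rule: infinite_finite_induct) (simp_all add: peval_zero peval_add)

lemma peval_mult: "peval (p * q) x = peval p x * peval q x"
proof -
  have single: "peval (Poly_Mapping.single e c * Poly_Mapping.single f d) x
      = peval (Poly_Mapping.single e c) x * peval (Poly_Mapping.single f d) x" for e f c d
    by (simp add: mult_single peval_single lookup_add power_add prod.distrib)
  have "peval ((\<Sum>e\<in>I. Poly_Mapping.single e (c e)) * (\<Sum>f\<in>J. Poly_Mapping.single f (d f))) x
      = peval (\<Sum>e\<in>I. Poly_Mapping.single e (c e)) x * peval (\<Sum>f\<in>J. Poly_Mapping.single f (d f)) x"
    for I J and c d :: "('a \<Rightarrow>\<^sub>0 nat) \<Rightarrow> real"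
    by (simp add: sum_product peval_sum single)
  from this[where I = "Poly_Mapping.keys p" and c = "Poly_Mapping.lookup p"
      and J = "Poly_Mapping.keys q" and d = "Poly_Mapping.lookup q"]
  show ?thesis
    by (simp only: rpoly_eq_sum_singles[symmetric])
qed

lemma peval_diff: "peval (p - q) x = peval p x - peval q x"
  using peval_add[of "p - q" q x] by simp

lemma peval_power: "peval (p ^ n) x = peval p x ^ n"
  by (induction n) (simp_all add: peval_one peval_mult)

lemmas peval_simps = peval_add peval_diff peval_mult peval_power peval_sum peval_pconst
  peval_pvar peval_zero peval_one

lemma continuous_on_peval [continuous_intros]:
  "continuous_on S f \<Longrightarrow> continuous_on S (\<lambda>z. peval p (f z))"
  unfolding peval_def by (intro continuous_intros)

section \<open>Positive semidefinite matrices as sums of rank-one squares\<close>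

lemma quadratic_form_sum: "v \<bullet> (B *v v) = (\<Sum>a\<in>UNIV. \<Sum>b\<in>UNIV. B $ a $ b * v $ a * v $ b)"
  for B :: "real^'n^'n"
  by (simp add: inner_vec_def matrix_vector_mult_def sum_distrib_left mult_ac)

lemma sym_mat_iff: "sym_mat B \<longleftrightarrow> (\<forall>a b. B $ a $ b = B $ b $ a)"
  by (auto simp: sym_mat_def transpose_def vec_eq_iff)

lemma quadratic_form_add_axis:
  fixes B :: "real^'n^'n"
  assumes "sym_mat B"
  shows "(v + t *\<^sub>R axis a 1) \<bullet> (B *v (v + t *\<^sub>R axis a 1))
    = v \<bullet> (B *v v) + 2 * t * (B *v v) $ a + t\<^sup>2 * B $ a $ a"
proof -
  have sym: "axis a 1 \<bullet> (B *v v) = v \<bullet> (B *v axis a 1)"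
    using assms by (metis dot_lmul_matrix inner_commute sym_mat_def vector_transpose_matrix)
  have "axis a 1 \<bullet> (B *v axis a 1) = B $ a $ a"
    by (simp add: inner_axis' matrix_vector_mult_basis column_def)
  with sym show ?thesis
    by (simp add: inner_axis' matrix_vector_right_distrib inner_add_left inner_add_right
        matrix_vector_mult_scaleR power2_eq_square algebra_simps)
qed

text \<open>
  The quadratic polynomial \<open>t \<mapsto> q(v + t e_a)\<close> is nonnegative, so its discriminant is not positive.
\<close>

lemma pos_semidef_Cauchy_Schwarz:
  fixes B :: "real^'n^'n"
  assumes "pos_semidef B"
  shows "((B *v v) $ a)\<^sup>2 \<le> B $ a $ a * (v \<bullet> (B *v v))" and "0 \<le> B $ a $ a"
proof -
  have "0 \<le> v \<bullet> (B *v v) + 2 * t * (B *v v) $ a + t\<^sup>2 * B $ a $ a" for v t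
    using assms quadratic_form_add_axis[of B v t a] by (metis pos_semidef_def)
  note nonneg = this
  show diag: "0 \<le> B $ a $ a"
    using nonneg[of 0 1] by simp
  show "((B *v v) $ a)\<^sup>2 \<le> B $ a $ a * (v \<bullet> (B *v v))"
  proof (cases "B $ a $ a = 0")
    case True
    have "(B *v v) $ a = 0"
    proof (rule ccontr)
      assume "(B *v v) $ a \<noteq> 0"
      then show False
        using nonneg[of v "- (v \<bullet> (B *v v) + 1) / (2 * (B *v v) $ a)"] True
        by (simp add: field_simps)
    qed
    with True show ?thesis by simp
  next
    case False
    then have pos: "0 < B $ a $ a" using diag by simp
    have "0 \<le> v \<bullet> (B *v v) - ((B *v v) $ a)\<^sup>2 / B $ a $ a"
      using nonneg[of v "- (B *v v) $ a / B $ a $ a"] pos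
      by (simp add: field_simps power2_eq_square)
    with pos show ?thesis by (simp add: field_simps)
  qed
qed

text \<open>
  One step of symmetric Gaussian elimination. The new quadratic form is \<open>q(v) - (B v)_a^2 / B_aa\<close>, which is
  nonnegative by the Cauchy-Schwarz inequality, and its row and column \<open>a\<close> vanish.
\<close>

lemma pos_semidef_eliminate:
  fixes B :: "real^'n^'n"
  assumes "pos_semidef B" "B $ a $ a \<noteq> 0"
  shows "pos_semidef (\<chi> b c. B $ b $ c - B $ b $ a * B $ c $ a / B $ a $ a)" (is "pos_semidef ?C")
proof -
  have sym: "B $ b $ c = B $ c $ b" for b c
    using assms(1) by (simp add: pos_semidef_def sym_mat_iff)
  have pos: "0 < B $ a $ a"
    using assms pos_semidef_Cauchy_Schwarz(2)[of B a] by simp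
  have "0 \<le> v \<bullet> (?C *v v)" for v
  proof -
    have "v \<bullet> (?C *v v) = v \<bullet> (B *v v)
        - (\<Sum>b\<in>UNIV. B $ b $ a * v $ b) * (\<Sum>c\<in>UNIV. B $ c $ a * v $ c) / B $ a $ a"
      by (simp add: quadratic_form_sum sum_product sum_divide_distrib algebra_simps sum_subtractf)
    also have "(\<Sum>b\<in>UNIV. B $ b $ a * v $ b) = (B *v v) $ a"
      by (simp add: matrix_vector_mult_def sym[of _ a])
    finally have "v \<bullet> (?C *v v) = v \<bullet> (B *v v) - ((B *v v) $ a)\<^sup>2 / B $ a $ a"
      by (simp only: power2_eq_square)
    moreover have "((B *v v) $ a)\<^sup>2 / B $ a $ a \<le> v \<bullet> (B *v v)"
      using pos_semidef_Cauchy_Schwarz(1)[OF assms(1), of v a] pos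
      by (simp add: divide_le_eq mult.commute)
    ultimately show ?thesis by linarith
  qed
  then show ?thesis
    using sym by (simp add: pos_semidef_def sym_mat_iff mult.commute)
qed

text \<open>
  By elimination: the induction runs over the set of indices whose columns may still be nonzero. If
  \<open>B_dd = 0\<close>, column \<open>d\<close> already vanishes; otherwise splitting off one rank-one term clears it.
\<close>

lemma pos_semidef_sum_rank_one:
  fixes B :: "real^'n^'n"
  assumes "pos_semidef B"
  shows "\<exists>(r::nat) u. \<forall>a b. B $ a $ b = (\<Sum>c<r. u c a * u c b)"
proof -
  have "\<exists>(r::nat) u. \<forall>a b. B $ a $ b = (\<Sum>c<r. u c a * u c b)"
    if "finite I" "pos_semidef B" "\<And>a b. a \<notin> I \<Longrightarrow> B $ b $ a = 0" for I and B :: "real^'n^'n"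
    using that
  proof (induction I arbitrary: B rule: finite_induct)
    case empty
    then show ?case by (intro exI[of _ 0]) simp
  next
    case (insert d I)
    have sym: "B $ b $ c = B $ c $ b" for b c
      using insert.prems(1) by (simp add: pos_semidef_def sym_mat_iff)
    show ?case
    proof (cases "B $ d $ d = 0")
      case True
      have "B $ b $ d = 0" for b
        using pos_semidef_Cauchy_Schwarz(1)[OF insert.prems(1), of "axis b 1" d] True
        by (simp add: matrix_vector_mult_basis column_def sym)
      then have "B $ b $ a = 0" if "a \<notin> I" for a b
        using insert.prems(2) that by (cases "a = d") auto
      then show ?thesis
        using insert.IH insert.prems(1) by blast
    next
      case False
      let ?C = "\<chi> b c. B $ b $ c - B $ b $ d * B $ c $ d / B $ d $ d"
      have "?C $ b $ a = 0" if "a \<notin> I" for a b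
        using insert.prems(2)[of a b] insert.prems(2)[of a d] sym[of a d] that False
        by (cases "a = d") simp_all
      then obtain r u where u: "\<And>a b. ?C $ a $ b = (\<Sum>c<(r::nat). u c a * u c b)"
        using insert.IH[OF pos_semidef_eliminate[OF insert.prems(1) False]] by blast
      have pos: "0 < B $ d $ d"
        using False pos_semidef_Cauchy_Schwarz(2)[OF insert.prems(1), of d] by simp
      define w where "w = u(r := \<lambda>b. B $ b $ d / sqrt (B $ d $ d))"
      have "B $ a $ b = (\<Sum>c<Suc r. w c a * w c b)" for a b
      proof -
        have "(\<Sum>c<r. w c a * w c b) = ?C $ a $ b"
          unfolding u by (intro sum.cong) (auto simp: w_def)
        moreover have "w r a * w r b = B $ a $ d * B $ b $ d / B $ d $ d"
          using pos by (simp add: w_def)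
        ultimately show ?thesis by simp
      qed
      then show ?thesis by blast
    qed
  qed
  from this[of UNIV B] show ?thesis
    using assms by auto
qed

section \<open>Affine functions that are nonnegative on the projected spectrahedron\<close>

text \<open>
  Moving along a direction orthogonal to \<open>a\<close> keeps the hypothesis of the implication, so \<open>b\<close> has no component
  there and \<open>b = \<beta> a\<close>. What is left is a statement about affine functions of the one number \<open>a \<bullet> x\<close>: its
  values far out give \<open>\<beta> \<ge> 0\<close>, those close to \<open>-c\<close> the inequality \<open>h \<le> \<beta> c\<close>.
\<close>

lemma affine_Farkas:
  fixes a b :: "'a::real_inner"
  assumes "a \<noteq> 0" and imp: "\<And>x. c + a \<bullet> x < 0 \<Longrightarrow> h + b \<bullet> x \<le> 0"
  shows "\<exists>\<beta>\<ge>0. b = \<beta> *\<^sub>R a \<and> h \<le> \<beta> * c"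
proof -
  define \<beta> where "\<beta> = (a \<bullet> b) / (a \<bullet> a)"
  \<comment> \<open>the component of \<open>b\<close> orthogonal to \<open>a\<close>\<close>
  define w where "w = b - \<beta> *\<^sub>R a"
  have aa: "0 < a \<bullet> a" using assms(1) by simp
  have wa: "a \<bullet> w = 0"
    using aa by (simp add: w_def \<beta>_def inner_diff_right)
  have bw: "b \<bullet> w = w \<bullet> w"
    using wa by (simp add: w_def inner_diff_left inner_commute)
  have key: "h + \<beta> * s + t * (w \<bullet> w) \<le> 0" if "c + s < 0" for s t
  proof -
    let ?x = "(s / (a \<bullet> a)) *\<^sub>R a + t *\<^sub>R w"
    have "a \<bullet> ?x = s" using aa wa by (simp add: inner_add_right)
    moreover have "b \<bullet> ?x = \<beta> * s + t * (w \<bullet> w)"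
      using aa bw by (simp add: inner_add_right \<beta>_def inner_commute)
    ultimately show ?thesis using imp[of ?x] that by simp
  qed
  have "w \<bullet> w = 0"
  proof (rule ccontr)
    assume "w \<bullet> w \<noteq> 0"
    then show False
      using key[of "- c - 1" "(1 - h - \<beta> * (- c - 1)) / (w \<bullet> w)"] by simp
  qed
  then have b: "b = \<beta> *\<^sub>R a" by (simp add: w_def)
  have beta: "0 \<le> \<beta>"
  proof (rule ccontr)
    assume neg: "\<not> 0 \<le> \<beta>"
    define s where "s = min (- c - 1) ((1 - h) / \<beta>)"
    have "1 - h \<le> \<beta> * s"
      using neg mult_left_mono_neg[of s "(1 - h) / \<beta>" \<beta>] by (simp add: s_def)
    moreover have "c + s < 0" by (simp add: s_def)
    ultimately show False using key[of s 0] by simp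
  qed
  have "h \<le> \<beta> * c"
  proof (rule field_le_epsilon)
    fix e :: real assume "0 < e"
    then have "h - \<beta> * c - \<beta> * (e / (\<beta> + 1)) \<le> 0"
      using key[of "- c - e / (\<beta> + 1)" 0] beta by (simp add: algebra_simps)
    moreover have "\<beta> * (e / (\<beta> + 1)) \<le> e"
      using beta \<open>0 < e\<close> by (simp add: field_simps)
    ultimately show "h \<le> \<beta> * c + e" by linarith
  qed
  with b beta show ?thesis by blast
qed

lemma sym_mat_add: "sym_mat B \<Longrightarrow> sym_mat C \<Longrightarrow> sym_mat (B + C)" for B C :: "real^'k^'k"
  by (simp add: sym_mat_iff)

lemma sym_mat_lincomb:
  fixes B :: "'i \<Rightarrow> real^'k^'k"
  assumes "\<And>i. i \<in> I \<Longrightarrow> sym_mat (B i)"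
  shows "sym_mat (\<Sum>i\<in>I. f i *\<^sub>R B i)"
  using assms by (auto simp: sym_mat_iff sum_component intro!: sum.cong)

lemma sym_mat_pencil:
  assumes "sym_mat A0" "\<And>i. sym_mat (A i)" "\<And>j. j \<in> {1..m} \<Longrightarrow> sym_mat (A' j)"
  shows "sym_mat (pencil m A0 A A' x y)"
  unfolding pencil_def using assms by (intro sym_mat_add sym_mat_lincomb) auto

lemma pencil_convex_comb:
  assumes "u + v = 1"
  shows "pencil m A0 A A' (u *\<^sub>R x + v *\<^sub>R x') (\<lambda>j. u * y j + v * y' j)
    = u *\<^sub>R pencil m A0 A A' x y + v *\<^sub>R pencil m A0 A A' x' y'"
proof -
  have "A0 = u *\<^sub>R A0 + v *\<^sub>R A0"
    using assms by (metis scaleR_add_left scaleR_one)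
  then show ?thesis
    by (simp add: pencil_def scaleR_add_left scaleR_add_right sum.distrib scaleR_sum_right)
qed

lemma quadratic_form_lincomb:
  fixes B C :: "real^'k^'k"
  shows "w \<bullet> ((u *\<^sub>R B + v *\<^sub>R C) *v w) = u * (w \<bullet> (B *v w)) + v * (w \<bullet> (C *v w))"
  by (simp add: matrix_vector_mult_add_rdistrib inner_add_right flip: scaleR_matrix_vector_assoc)

lemma convex_proj_spectrahedron: "convex (proj_spectrahedron m A0 A A')"
proof (rule convexI)
  fix x x' and u v :: real
  assume "x \<in> proj_spectrahedron m A0 A A'" "x' \<in> proj_spectrahedron m A0 A A'"
    and uv: "0 \<le> u" "0 \<le> v" "u + v = 1"
  then obtain y y' where "pos_semidef (pencil m A0 A A' x y)" "pos_semidef (pencil m A0 A A' x' y')"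
    by (auto simp: proj_spectrahedron_def)
  then have "pos_semidef (pencil m A0 A A' (u *\<^sub>R x + v *\<^sub>R x') (\<lambda>j. u * y j + v * y' j))"
    using uv by (simp add: pencil_convex_comb pos_semidef_def quadratic_form_lincomb sym_mat_iff)
  then show "u *\<^sub>R x + v *\<^sub>R x' \<in> proj_spectrahedron m A0 A A'"
    by (auto simp: proj_spectrahedron_def)
qed

text \<open>
  For \<open>S = \<Sum> u u^T\<close> the inner product is \<open>\<Sum> u^T B u\<close>, and some \<open>u\<close> is nonzero.
\<close>

lemma inner_pos_def_pos:
  fixes S B :: "real^'k^'k"
  assumes "pos_semidef S" "S \<noteq> 0" "pos_def B"
  shows "0 < S \<bullet> B"
proof -
  obtain r :: nat and u where u: "\<And>a b. S $ a $ b = (\<Sum>c<r. u c a * u c b)"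
    using pos_semidef_sum_rank_one[OF assms(1)] by blast
  have "S \<bullet> B = (\<Sum>a\<in>UNIV. \<Sum>b\<in>UNIV. \<Sum>c<r. B $ a $ b * u c a * u c b)"
    by (simp add: inner_vec_def u sum_distrib_left mult_ac)
  also have "\<dots> = (\<Sum>c<r. \<Sum>a\<in>UNIV. \<Sum>b\<in>UNIV. B $ a $ b * u c a * u c b)"
    by (subst (2) sum.swap, subst sum.swap) simp
  also have "\<dots> = (\<Sum>c<r. (\<chi> a. u c a) \<bullet> (B *v (\<chi> a. u c a)))"
    by (simp add: quadratic_form_sum)
  finally have eq: "S \<bullet> B = (\<Sum>c<r. (\<chi> a. u c a) \<bullet> (B *v (\<chi> a. u c a)))" .
  have pos: "0 < w \<bullet> (B *v w)" if "w \<noteq> 0" for w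
    using assms(3) that by (simp add: pos_def_def)
  have nonneg: "0 \<le> w \<bullet> (B *v w)" for w
    using pos[of w] by (cases "w = 0") auto
  have "\<exists>c<r. (\<chi> a. u c a) \<noteq> 0"
  proof (rule ccontr)
    assume "\<not> ?thesis"
    then have "u c a = 0" if "c < r" for c a
      using that by (metis vec_lambda_beta zero_index)
    then show False
      using assms(2) by (simp add: vec_eq_iff u)
  qed
  then obtain c where c: "c < r" "(\<chi> a. u c a) \<noteq> 0" by blast
  show ?thesis
    unfolding eq using c nonneg pos by (intro sum_pos2[of _ c]) auto
qed

text \<open>
  The cone here consists of all matrices with a nonnegative quadratic form, symmetric or not. It therefore
  contains every skew-symmetric matrix together with its negative, and duality against these forces \<open>S\<close> to be
  symmetric; duality against \<open>v v^T\<close> gives positivity.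
\<close>

lemma pos_semidef_if_dual:
  fixes S :: "real^'k^'k"
  assumes dual: "\<And>M. (\<And>v. 0 \<le> v \<bullet> (M *v v)) \<Longrightarrow> 0 \<le> S \<bullet> M"
  shows "pos_semidef S"
proof -
  let ?T = "transpose S"
  have ST: "?T \<bullet> ?T = S \<bullet> S"
    by (simp add: inner_vec_def transpose_def) (rule sum.swap)
  have qf: "v \<bullet> ((S - ?T) *v v) = 0" for v
    by (simp add: quadratic_form_sum transpose_def left_diff_distrib sum_subtractf)
       (subst (2) sum.swap, simp add: mult_ac)
  have "v \<bullet> ((?T - S) *v v) = 0" for v
    using qf[of v] by (simp add: matrix_vector_mult_diff_rdistrib inner_diff_right)
  with qf have "0 \<le> S \<bullet> (S - ?T)" "0 \<le> S \<bullet> (?T - S)"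
    by (intro dual; simp)+
  then have "(S - ?T) \<bullet> (S - ?T) = 0"
    using ST by (simp add: inner_diff_left inner_diff_right inner_commute)
  then have "sym_mat S" by (simp add: sym_mat_def)
  moreover have "0 \<le> v \<bullet> (S *v v)" for v
  proof -
    let ?M = "\<chi> a b. v $ a * v $ b"
    have "w \<bullet> (?M *v w) = (v \<bullet> w)\<^sup>2" for w
      unfolding quadratic_form_sum
      by (simp add: inner_vec_def power2_eq_square sum_product mult_ac)
    then have "0 \<le> S \<bullet> ?M" by (intro dual) simp
    also have "S \<bullet> ?M = v \<bullet> (S *v v)"
      unfolding quadratic_form_sum by (simp add: inner_vec_def mult_ac)
    finally show ?thesis .
  qed
  ultimately show ?thesis by (simp add: pos_semidef_def)
qed

lemma inner_pencil: 
  "S \<bullet> pencil m A0 A A' x y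
    = S \<bullet> A0 + (\<chi> i. S \<bullet> A i) \<bullet> x + (\<Sum>j=1..m. y j * (S \<bullet> A' j))"
  by (simp add: pencil_def inner_add_right inner_sum_right inner_vec_def[of "\<chi> i. S \<bullet> A i"] mult.commute)

text \<open>
  The matrices of the pencil at points with \<open>c + a \<bullet> x < 0\<close> are separated from the cone \<open>P\<close> of matrices with
  nonnegative quadratic form by some \<open>S \<noteq> 0\<close>. Then \<open>S \<bullet> A(x,y) \<le> 0\<close> at these points for every \<open>y\<close>, so \<open>S\<close> is
  orthogonal to all \<open>A'_j\<close>, and \<open>affine_Farkas\<close> compares the two affine functions. At a strictly feasible
  point \<open>S \<bullet> A(x,y) > 0\<close>, which excludes the factor \<open>\<beta> = 0\<close>.
\<close>

lemma nonneg_affine_certificate: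
  fixes A0 :: "real^'k^'k" and A :: "'d::finite \<Rightarrow> real^'k^'k"
  assumes sym: "sym_mat A0" "\<And>i. sym_mat (A i)" "\<And>j. j \<in> {1..m} \<Longrightarrow> sym_mat (A' j)"
    and feas: "strictly_feasible m A0 A A'"
    and nonneg: "\<And>x. x \<in> proj_spectrahedron m A0 A A' \<Longrightarrow> 0 \<le> c + a \<bullet> x"
  shows "\<exists>c0\<ge>0. \<exists>S. pos_semidef S \<and> (\<forall>j\<in>{1..m}. S \<bullet> A' j = 0) \<and>
    c = c0 + S \<bullet> A0 \<and> (\<forall>i. a $ i = S \<bullet> A i)"
proof -
  obtain x0 y0 where pd: "pos_def (pencil m A0 A A' x0 y0)"
    using feas by (auto simp: strictly_feasible_def)
  have "0 \<le> v \<bullet> (pencil m A0 A A' x0 y0 *v v)" for v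
    using pd by (cases "v = 0") (auto simp: pos_def_def intro: less_imp_le)
  then have "x0 \<in> proj_spectrahedron m A0 A A'"
    using pd by (auto simp: proj_spectrahedron_def pos_semidef_def pos_def_def)
  then have f0: "0 \<le> c + a \<bullet> x0" by (rule nonneg)
  show ?thesis
  proof (cases "a = 0")
    case True
    then show ?thesis
      using f0 by (intro exI[of _ c] exI[of _ 0] conjI) (auto simp: pos_semidef_def sym_mat_iff)
  next
    case False
    define P where "P = {M :: real^'k^'k. \<forall>v. 0 \<le> v \<bullet> (M *v v)}"
    define D where "D = {pencil m A0 A A' x y | x y. c + a \<bullet> x < 0}"
    have "convex P"
      unfolding P_def by (rule convexI) (simp add: quadratic_form_lincomb)
    moreover have "convex D"
    proof (rule convexI)
      fix M M' and u v :: real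
      assume "M \<in> D" "M' \<in> D" and uv: "0 \<le> u" "0 \<le> v" "u + v = 1"
      then obtain x y x' y' where
        M: "M = pencil m A0 A A' x y" "c + a \<bullet> x < 0"
           "M' = pencil m A0 A A' x' y'" "c + a \<bullet> x' < 0"
        by (auto simp: D_def)
      have "c + a \<bullet> (u *\<^sub>R x + v *\<^sub>R x') = u * (c + a \<bullet> x) + v * (c + a \<bullet> x')"
        using uv(3) by (simp add: inner_add_right algebra_simps flip: distrib_left)
      also have "\<dots> < 0"
        using convex_bound_lt[OF M(2,4) uv] .
      finally show "u *\<^sub>R M + v *\<^sub>R M' \<in> D"
        unfolding D_def M(1,3) pencil_convex_comb[OF uv(3), symmetric] by blast
    qed
    moreover have "P \<noteq> {}"
      by (auto simp: P_def intro!: exI[of _ 0])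
    moreover have "D \<noteq> {}"
    proof -
      have "c + a \<bullet> ((- (c + 1) / (a \<bullet> a)) *\<^sub>R a) < 0"
        using False by (simp add: field_simps)
      then show ?thesis unfolding D_def by blast
    qed
    moreover have "D \<inter> P = {}"
    proof -
      have "\<not> c + a \<bullet> x < 0" if "\<forall>v. 0 \<le> v \<bullet> (pencil m A0 A A' x y *v v)" for x y
      proof -
        have "pos_semidef (pencil m A0 A A' x y)"
          unfolding pos_semidef_def using that sym_mat_pencil[of A0 A m A' x y, OF sym] by blast
        then have "x \<in> proj_spectrahedron m A0 A A'"
          by (auto simp: proj_spectrahedron_def)
        then show ?thesis using nonneg by fastforce
      qed
      then show ?thesis by (auto simp: D_def P_def)
    qed
    ultimately have "\<exists>S b. S \<noteq> 0 \<and> (\<forall>M\<in>D. S \<bullet> M \<le> b) \<and> (\<forall>M\<in>P. b \<le> S \<bullet> M)"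
      by (intro separating_hyperplane_sets)
    then obtain S b where S: "S \<noteq> 0"
      and D: "\<And>M. M \<in> D \<Longrightarrow> S \<bullet> M \<le> b" and P: "\<And>M. M \<in> P \<Longrightarrow> b \<le> S \<bullet> M"
      by blast
    have b: "b \<le> 0" using P[of 0] by (simp add: P_def)
    have "0 \<le> S \<bullet> M" if M: "\<And>v. 0 \<le> v \<bullet> (M *v v)" for M
    proof (rule ccontr)
      assume neg: "\<not> 0 \<le> S \<bullet> M"
      \<comment> \<open>\<open>P\<close> is a cone, and the multiple \<open>t M\<close> would have the value \<open>b - 1\<close>\<close>
      define t where "t = (b - 1) / (S \<bullet> M)"
      have "0 \<le> t" using neg b by (auto simp: t_def intro!: divide_nonpos_nonpos)
      then have "t *\<^sub>R M \<in> P"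
        using quadratic_form_lincomb[of _ t M 0 0] M by (simp add: P_def)
      from P[OF this] show False using neg by (simp add: t_def)
    qed
    then have psd: "pos_semidef S" by (rule pos_semidef_if_dual)
    let ?h = "S \<bullet> A0" and ?b = "\<chi> i. S \<bullet> A i"
    have le: "?h + ?b \<bullet> x + (\<Sum>j=1..m. y j * (S \<bullet> A' j)) \<le> 0" if "c + a \<bullet> x < 0" for x y
      using D[of "pencil m A0 A A' x y"] that b by (force simp: inner_pencil D_def)
    have orth: "S \<bullet> A' j = 0" if j: "j \<in> {1..m}" for j
    proof (rule ccontr)
      assume nz: "S \<bullet> A' j \<noteq> 0"
      let ?x = "(- (c + 1) / (a \<bullet> a)) *\<^sub>R a"
      \<comment> \<open>chosen so that the value at \<open>?x\<close> and \<open>y_j = ?t\<close> is \<open>1\<close>\<close>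
      let ?t = "(1 - ?h - ?b \<bullet> ?x) / (S \<bullet> A' j)"
      have "c + a \<bullet> ?x < 0"
        using False by (simp add: field_simps)
      from le[OF this, of "\<lambda>i. if i = j then ?t else 0"] show False
        using nz j by (simp add: if_distrib[of "\<lambda>t. t * _"] cong: if_cong)
    qed
    have "?h + ?b \<bullet> x \<le> 0" if "c + a \<bullet> x < 0" for x
      using le[OF that, of "\<lambda>_. 0"] by simp
    then obtain \<beta> where \<beta>: "0 \<le> \<beta>" "?b = \<beta> *\<^sub>R a" "?h \<le> \<beta> * c"
      using affine_Farkas[OF False, of c ?h ?b] by blast
    have "0 < S \<bullet> pencil m A0 A A' x0 y0"
      using inner_pos_def_pos[OF psd S pd] .
    then have "0 < ?h + ?b \<bullet> x0"
      using orth by (simp add: inner_pencil)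
    then have "\<beta> \<noteq> 0" using \<beta> by auto
    then have pos: "0 < \<beta>" using \<beta>(1) by simp
    have "a $ i = (S \<bullet> A i) / \<beta>" for i
      using arg_cong[OF \<beta>(2), of "\<lambda>v. v $ i"] pos by (simp add: field_simps)
    moreover have "pos_semidef ((1 / \<beta>) *\<^sub>R S)"
      using psd pos quadratic_form_lincomb[of _ "1 / \<beta>" S 0 0]
      by (simp add: pos_semidef_def sym_mat_iff)
    ultimately show ?thesis
      using \<beta>(3) pos orth
      by (intro exI[of _ "c - ?h / \<beta>"] exI[of _ "(1 / \<beta>) *\<^sub>R S"] conjI) (auto simp: field_simps)
  qed
qed

section \<open>Bernstein expansions on a cube\<close>

text \<open>
  The coefficient of \<open>t^m\<close> with respect to the Bernstein polynomials of degree \<open>N\<close> is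
  \<open>(j choose m) / (N choose m)\<close>. With \<open>\<tau> = j / N\<close> and \<open>h = 1 / N\<close> it is the product below, a continuous function of
  \<open>\<tau>\<close> and \<open>h\<close> that equals \<open>\<tau>^m\<close> at \<open>h = 0\<close>. The maximum does not change the value for small \<open>h\<close> and keeps the
  denominator away from zero, so that continuity holds everywhere.
\<close>

definition falling_ratio :: "nat \<Rightarrow> real \<Rightarrow> real \<Rightarrow> real"
  where "falling_ratio m \<tau> h = (\<Prod>i<m. (\<tau> - real i * h) / max (1/2) (1 - real i * h))"

text \<open>
  The Bernstein coefficients of \<open>x^k\<close> on \<open>[-R,R]\<close>, obtained from \<open>x = 2 R t - R\<close>; in \<open>bern_coeff\<close> they are
  multiplied over the variables of a monomial.
\<close>

definition bern_power :: "real \<Rightarrow> nat \<Rightarrow> real \<Rightarrow> real \<Rightarrow> real"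
  where "bern_power R k \<tau> h =
    (\<Sum>m\<le>k. real (k choose m) * (2 * R) ^ m * (- R) ^ (k - m) * falling_ratio m \<tau> h)"

definition bern_coeff :: "real \<Rightarrow> 'd::finite rpoly \<Rightarrow> real^'d \<Rightarrow> real \<Rightarrow> real"
  where "bern_coeff R p \<tau> h = (\<Sum>e\<in>Poly_Mapping.keys p.
    Poly_Mapping.lookup p e * (\<Prod>i\<in>UNIV. bern_power R (Poly_Mapping.lookup e i) (\<tau> $ i) h))"

definition bern_basis :: "real \<Rightarrow> nat \<Rightarrow> ('d::finite \<Rightarrow> nat) \<Rightarrow> 'd rpoly"
  where "bern_basis R N J = (\<Prod>i\<in>UNIV. pconst (real (N choose J i)) *
    (pconst (1 / (2 * R)) * (pconst R + pvar i)) ^ J i *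
    (pconst (1 / (2 * R)) * (pconst R - pvar i)) ^ (N - J i))"

lemma continuous_on_bern_power [continuous_intros]:
  assumes "continuous_on S f" "continuous_on S g"
  shows "continuous_on S (\<lambda>z. bern_power R k (f z) (g z))"
  unfolding bern_power_def falling_ratio_def using assms
  by (intro continuous_intros) (auto simp: max_def)

lemma continuous_on_bern_coeff [continuous_intros]:
  assumes "continuous_on S f" "continuous_on S g"
  shows "continuous_on S (\<lambda>z. bern_coeff R p (f z) (g z))"
  unfolding bern_coeff_def using assms by (intro continuous_intros)

lemma bern_power_at_0: "bern_power R k \<tau> 0 = (2 * R * \<tau> - R) ^ k"
proof -
  have "falling_ratio m \<tau> 0 = \<tau> ^ m" for m
    by (simp add: falling_ratio_def)
  then show ?thesis
    using binomial_ring[of "2 * R * \<tau>" "- R" k]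
    by (simp add: bern_power_def power_mult_distrib mult_ac)
qed

lemma bern_coeff_at_0: "bern_coeff R p \<tau> 0 = peval p (\<chi> i. 2 * R * \<tau> $ i - R)"
  by (simp add: bern_coeff_def peval_def bern_power_at_0)

lemma falling_ratio_eq_binomial:
  assumes "j \<le> N" "2 * m \<le> N" "0 < N"
  shows "falling_ratio m (real j / real N) (1 / real N) = real (j choose m) / real (N choose m)"
proof -
  have "(real j / real N - real i * (1 / real N)) / max (1/2) (1 - real i * (1 / real N))
      = (real j - real i) / (real N - real i)" if "i < m" for i
  proof -
    have "1 / 2 \<le> 1 - real i * (1 / real N)"
      using that assms by (simp add: field_simps)
    then have "max (1/2) (1 - real i * (1 / real N)) = (real N - real i) / real N"
      using assms by (simp add: max_def field_simps)
    then show ?thesis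
      using assms by (simp add: diff_divide_distrib[symmetric])
  qed
  then have "falling_ratio m (real j / real N) (1 / real N)
      = (\<Prod>i<m. real j - real i) / (\<Prod>i<m. real N - real i)"
    by (simp add: falling_ratio_def prod_dividef)
  moreover have "(\<Prod>i<m. real n - real i) = fact m * real (n choose m)" for n
    by (simp add: binomial_gbinomial gbinomial_prod_rev lessThan_atLeast0)
  ultimately show ?thesis by simp
qed

text \<open>
  Multiply \<open>t^m\<close> by \<open>(t + s)^(N - m) = 1\<close> and expand.
\<close>

lemma power_eq_Bernstein_sum:
  fixes t s :: "'d::finite rpoly"
  assumes "t + s = 1" "m \<le> N"
  shows "t ^ m = (\<Sum>j\<le>N. pconst (real (j choose m) / real (N choose m)) *
    (pconst (real (N choose j)) * t ^ j * s ^ (N - j)))"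
proof -
  let ?f = "\<lambda>j. pconst (real (j choose m) / real (N choose m)) *
    (pconst (real (N choose j)) * t ^ j * s ^ (N - j))"
  have "t ^ m = t ^ m * (t + s) ^ (N - m)"
    using assms by simp
  also have "\<dots> = (\<Sum>i\<le>N - m. t ^ m * (of_nat (N - m choose i) * t ^ i * s ^ (N - m - i)))"
    by (simp add: binomial_ring sum_distrib_left)
  also have "\<dots> = (\<Sum>i\<le>N - m. ?f (i + m))"
  proof (intro sum.cong refl)
    fix i assume "i \<in> {..N - m}"
    then have i: "i + m \<le> N" using assms by auto
    have "real (N choose (i + m)) * real ((i + m) choose m)
        = real (N choose m) * real (N - m choose i)"
      using choose_mult[of m "i + m" N] i by (simp flip: of_nat_mult)
    then have "real ((i + m) choose m) / real (N choose m) * real (N choose (i + m))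
        = real (N - m choose i)"
      using assms by (simp add: field_simps)
    then have c: "pconst (real ((i + m) choose m) / real (N choose m)) * pconst (real (N choose (i + m)))
        = (of_nat (N - m choose i) :: 'd rpoly)"
      by (metis pconst_simps(3) pconst_of_nat)
    have "?f (i + m) = (pconst (real ((i + m) choose m) / real (N choose m)) *
        pconst (real (N choose (i + m)))) * (t ^ (i + m) * s ^ (N - (i + m)))"
      by (simp only: mult.assoc)
    also have "\<dots> = t ^ m * (of_nat (N - m choose i) * t ^ i * s ^ (N - m - i))"
      unfolding c by (simp add: power_add mult_ac diff_diff_eq add.commute)
    finally show "t ^ m * (of_nat (N - m choose i) * t ^ i * s ^ (N - m - i)) = ?f (i + m)" ..
  qed
  also have "\<dots> = (\<Sum>j\<in>{m..N}. ?f j)"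
    using assms by (intro sum.reindex_bij_witness[of _ "\<lambda>j. j - m" "\<lambda>i. i + m"]) auto
  also have "\<dots> = (\<Sum>j\<le>N. ?f j)"
    by (intro sum.mono_neutral_left) (auto simp: pconst_simps binomial_eq_0)
  finally show ?thesis .
qed

lemma pvar_power_eq_Bernstein_sum:
  fixes i :: "'d::finite"
  assumes "0 < R" "2 * k \<le> N" "0 < N"
  defines "t \<equiv> pconst (1 / (2 * R)) * (pconst R + pvar i)"
    and "s \<equiv> pconst (1 / (2 * R)) * (pconst R - pvar i)"
  shows "pvar i ^ k = (\<Sum>j\<le>N. pconst (bern_power R k (real j / real N) (1 / real N)) *
    (pconst (real (N choose j)) * t ^ j * s ^ (N - j)))"
proof -
  let ?b = "\<lambda>j. pconst (real (N choose j)) * t ^ j * s ^ (N - j)"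
  have half: "pconst (1 / (2 * R)) * pconst R = pconst (1 / 2)"
    using assms(1) by (simp flip: pconst_simps(3))
  have "t + s = pconst (1 / 2) + pconst (1 / 2)"
    unfolding t_def s_def half[symmetric] by (simp add: algebra_simps)
  then have ts: "t + s = 1"
    by (simp flip: pconst_simps)
  have "pconst (2 * R) * t = (pconst (2 * R) * pconst (1 / (2 * R))) * (pconst R + pvar i)"
    by (simp add: t_def mult.assoc)
  also have "pconst (2 * R) * pconst (1 / (2 * R)) = 1"
    using assms(1) by (simp flip: pconst_simps)
  finally have scaled: "pconst (2 * R) * t = pconst R + pvar i"
    by simp
  have "pvar i = pconst (2 * R) * t + pconst (- R)"
    unfolding scaled by (simp add: pconst_simps)
  then have "pvar i ^ k = (\<Sum>m\<le>k. of_nat (k choose m) * (pconst (2 * R) * t) ^ m * pconst (- R) ^ (k - m))"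
    by (simp add: binomial_ring)
  also have "\<dots> = (\<Sum>m\<le>k. pconst (real (k choose m) * (2 * R) ^ m * (- R) ^ (k - m)) * t ^ m)"
    by (intro sum.cong refl)
       (simp only: pconst_simps pconst_power pconst_of_nat power_mult_distrib mult_ac)
  also have "\<dots> = (\<Sum>m\<le>k. pconst (real (k choose m) * (2 * R) ^ m * (- R) ^ (k - m)) *
      (\<Sum>j\<le>N. pconst (falling_ratio m (real j / real N) (1 / real N)) * ?b j))"
  proof (intro sum.cong refl arg_cong2[where f = "(*)"])
    fix m assume "m \<in> {..k}"
    then have m: "2 * m \<le> N" "m \<le> N" using assms(2) by auto
    show "t ^ m = (\<Sum>j\<le>N. pconst (falling_ratio m (real j / real N) (1 / real N)) * ?b j)"
      unfolding power_eq_Bernstein_sum[OF ts m(2)]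
      by (intro sum.cong refl) (simp add: falling_ratio_eq_binomial m(1) assms(3))
  qed
  also have "\<dots> = (\<Sum>j\<le>N. \<Sum>m\<le>k. pconst (real (k choose m) * (2 * R) ^ m * (- R) ^ (k - m) *
      falling_ratio m (real j / real N) (1 / real N)) * ?b j)"
    unfolding sum_distrib_left
    by (subst sum.swap) (simp only: pconst_simps mult.assoc)
  finally show ?thesis
    by (simp only: bern_power_def pconst_sum sum_distrib_right)
qed

text \<open>
  The expansion is exact as soon as the degree \<open>N\<close> is at least twice the degree of \<open>p\<close> in each variable; the factor
  two keeps \<open>1 - i h \<ge> 1/2\<close>, where the maximum in \<open>falling_ratio\<close> has no effect.
\<close>

lemma Bernstein_expansion:
  fixes p :: "'d::finite rpoly"
  assumes "0 < R" "0 < N" "\<And>e i. e \<in> Poly_Mapping.keys p \<Longrightarrow> 2 * Poly_Mapping.lookup e i \<le> N"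
  shows "p = (\<Sum>J\<in>(UNIV :: 'd set) \<rightarrow>\<^sub>E {..N}.
    pconst (bern_coeff R p (\<chi> i. real (J i) / real N) (1 / real N)) * bern_basis R N J)"
proof -
  let ?b = "\<lambda>i j. pconst (real (N choose j)) *
    (pconst (1 / (2 * R)) * (pconst R + pvar i)) ^ j *
    (pconst (1 / (2 * R)) * (pconst R - pvar i)) ^ (N - j) :: 'd rpoly"
  let ?u = "\<lambda>e J i. bern_power R (Poly_Mapping.lookup e i) (real (J i) / real N) (1 / real N)"
  have "Poly_Mapping.single e (Poly_Mapping.lookup p e) =
      (\<Sum>J\<in>UNIV \<rightarrow>\<^sub>E {..N}. pconst (Poly_Mapping.lookup p e * (\<Prod>i\<in>UNIV. ?u e J i)) * bern_basis R N J)"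
    if "e \<in> Poly_Mapping.keys p" for e
  proof -
    have "(\<Prod>i\<in>UNIV. pvar i ^ Poly_Mapping.lookup e i) = (\<Prod>i\<in>UNIV. \<Sum>j\<le>N.
        pconst (bern_power R (Poly_Mapping.lookup e i) (real j / real N) (1 / real N)) * ?b i j)"
      using assms that by (intro prod.cong refl pvar_power_eq_Bernstein_sum)
    also have "\<dots> = (\<Sum>J\<in>UNIV \<rightarrow>\<^sub>E {..N}. \<Prod>i\<in>UNIV. pconst (?u e J i) * ?b i (J i))"
      by (subst prod_sum_PiE) auto
    also have "\<dots> = (\<Sum>J\<in>UNIV \<rightarrow>\<^sub>E {..N}. pconst (\<Prod>i\<in>UNIV. ?u e J i) * bern_basis R N J)"
      by (simp only: prod.distrib bern_basis_def pconst_prod)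
    finally show ?thesis
      unfolding single_eq_monomial by (simp only: sum_distrib_left pconst_simps mult.assoc)
  qed
  then have "p = (\<Sum>e\<in>Poly_Mapping.keys p. \<Sum>J\<in>UNIV \<rightarrow>\<^sub>E {..N}.
      pconst (Poly_Mapping.lookup p e * (\<Prod>i\<in>UNIV. ?u e J i)) * bern_basis R N J)"
    using rpoly_eq_sum_singles[of p] by simp
  then show ?thesis
    by (subst (asm) sum.swap) (simp only: bern_coeff_def pconst_sum sum_distrib_right vec_lambda_beta)
qed

section \<open>Two compactness arguments\<close>

lemma compact_sublevel:
  fixes f :: "'a::t2_space \<Rightarrow> real"
  assumes "compact X" "continuous_on X f"
  shows "compact {z \<in> X. f z \<le> c}"
proof -
  have "closed {z \<in> X. f z \<le> c}"
    using assms by (intro continuous_on_closed_Collect_le compact_imp_closed continuous_on_const)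
  moreover have "{z \<in> X. f z \<le> c} = X \<inter> {z \<in> X. f z \<le> c}" by auto
  ultimately show ?thesis
    using assms(1) by (metis compact_Int_closed)
qed

lemma pos_on_compact_bounded_below:
  fixes f :: "'a::topological_space \<Rightarrow> real"
  assumes "compact X" "continuous_on X f" "\<And>z. z \<in> X \<Longrightarrow> 0 < f z"
  shows "\<exists>\<eta>>0. \<forall>z\<in>X. \<eta> \<le> f z"
proof (cases "X = {}")
  case False
  then show ?thesis
    using continuous_attains_inf[OF assms(1) False assms(2)] assms(3) by blast
qed (auto intro: exI[of _ 1])

text \<open>
  By Bernoulli, \<open>n g \<le> (1 + g)^n\<close>, and \<open>(1 + g)^n (1 - g)^n \<le> 1\<close>.
\<close>

lemma mult_power_one_minus_le:
  fixes g :: real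
  assumes "0 \<le> g" "g \<le> 1" "0 < n"
  shows "g * (1 - g) ^ n \<le> 1 / real n"
proof -
  have "(real n * g) * (1 - g) ^ n \<le> (1 + g) ^ n * (1 - g) ^ n"
    using assms Bernoulli_inequality[of g n] by (intro mult_right_mono) auto
  also have "\<dots> = (1 - g\<^sup>2) ^ n"
    by (simp add: power_mult_distrib[symmetric] power2_eq_square algebra_simps)
  also have "\<dots> \<le> 1"
    using assms by (intro power_le_one) (auto simp: power_le_one)
  finally show ?thesis
    using assms by (simp add: field_simps)
qed

text \<open>
  The penalty \<open>\<mu> g (1 - g)^(2k)\<close> is at most \<open>-\<mu> \<delta>\<close> where \<open>g < -\<delta>\<close>, and at most \<open>\<mu> / (2k)\<close> everywhere. So \<open>\<delta>\<close> is chosen such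
  that \<open>\<phi>\<close> is still positive on \<open>g \<ge> -\<delta>\<close>, then \<open>\<mu>\<close> such that \<open>\<mu> \<delta>\<close> exceeds the bound of \<open>\<bar>\<phi>\<bar>\<close>, and finally
  \<open>k\<close> such that \<open>\<mu> / (2k)\<close> is below the minimum of \<open>\<phi>\<close> on \<open>g \<ge> -\<delta>\<close>.
\<close>

lemma penalty_makes_positive:
  fixes \<phi> g :: "'a::t2_space \<Rightarrow> real"
  assumes X: "compact X" and cont: "continuous_on X \<phi>" "continuous_on X g"
    and le1: "\<And>z. z \<in> X \<Longrightarrow> g z \<le> 1"
    and pos: "\<And>z. z \<in> X \<Longrightarrow> 0 \<le> g z \<Longrightarrow> 0 < \<phi> z"
  shows "\<exists>\<mu>\<ge>0. \<exists>k. \<forall>z\<in>X. 0 < \<phi> z - \<mu> * (g z * ((1 - g z) ^ k * (1 - g z) ^ k))"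
proof -
  have "\<exists>\<epsilon>>0. \<forall>z\<in>{z \<in> X. \<phi> z \<le> 0}. \<epsilon> \<le> - g z"
  proof (intro pos_on_compact_bounded_below)
    show "compact {z \<in> X. \<phi> z \<le> 0}"
      using X cont(1) by (rule compact_sublevel)
    show "continuous_on {z \<in> X. \<phi> z \<le> 0} (\<lambda>z. - g z)"
      using continuous_on_subset[OF cont(2)] by (auto intro!: continuous_intros)
  qed (use pos in force)
  then obtain \<epsilon> where \<epsilon>: "0 < \<epsilon>" "\<And>z. z \<in> X \<Longrightarrow> \<phi> z \<le> 0 \<Longrightarrow> \<epsilon> \<le> - g z" by blast
  define \<delta> where "\<delta> = \<epsilon> / 2"
  have \<delta>: "0 < \<delta>" "\<delta> < \<epsilon>" using \<epsilon>(1) by (auto simp: \<delta>_def)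
  have "\<exists>\<eta>>0. \<forall>z\<in>{z \<in> X. - g z \<le> \<delta>}. \<eta> \<le> \<phi> z"
  proof (intro pos_on_compact_bounded_below)
    show "compact {z \<in> X. - g z \<le> \<delta>}"
      using X cont(2) by (intro compact_sublevel continuous_intros)
    show "continuous_on {z \<in> X. - g z \<le> \<delta>} \<phi>"
      using cont(1) by (rule continuous_on_subset) auto
    show "0 < \<phi> z" if "z \<in> {z \<in> X. - g z \<le> \<delta>}" for z
      using that \<epsilon>(2)[of z] \<delta> by force
  qed
  then obtain \<eta> where \<eta>: "0 < \<eta>" "\<And>z. z \<in> X \<Longrightarrow> - g z \<le> \<delta> \<Longrightarrow> \<eta> \<le> \<phi> z" by blast
  have "bounded (\<phi> ` X)"
    using compact_continuous_image[OF cont(1) X] by (rule compact_imp_bounded)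
  then obtain C where C: "0 < C" "\<And>z. z \<in> X \<Longrightarrow> \<bar>\<phi> z\<bar> \<le> C"
    by (auto simp: bounded_pos)
  define \<mu> where "\<mu> = (C + 1) / \<delta>"
  have \<mu>: "0 < \<mu>" using C \<delta> by (simp add: \<mu>_def)
  obtain k where k: "\<mu> / \<eta> < real k"
    using reals_Archimedean2 by blast
  have "0 < \<mu> / \<eta>" using \<mu> \<eta> by simp
  then have k0: "0 < k" using k by linarith
  have "0 < \<phi> z - \<mu> * (g z * ((1 - g z) ^ k * (1 - g z) ^ k))" if z: "z \<in> X" for z
  proof (cases "- g z \<le> \<delta>")
    case near: True
    have "\<mu> * (g z * (1 - g z) ^ (k + k)) < \<eta>"
    proof (cases "0 \<le> g z")
      case True
      have "\<mu> * (g z * (1 - g z) ^ (k + k)) \<le> \<mu> * (1 / real (k + k))"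
        using True le1[OF z] k0 \<mu> by (intro mult_left_mono mult_power_one_minus_le) auto
      also have "\<dots> < \<eta>"
        using k k0 \<eta>(1) \<mu> by (simp add: field_simps)
      finally show ?thesis .
    next
      case False
      then have "\<mu> * (g z * (1 - g z) ^ (k + k)) \<le> 0"
        using \<mu> by (intro mult_nonneg_nonpos mult_nonpos_nonneg) auto
      then show ?thesis using \<eta>(1) by linarith
    qed
    then show ?thesis
      using \<eta>(2)[OF z near] by (simp add: power_add)
  next
    case False
    have "1 \<le> (1 - g z) ^ (k + k)"
      using False \<delta> by (intro one_le_power) auto
    then have "g z * (1 - g z) ^ (k + k) \<le> g z * 1"
      using False \<delta> by (intro mult_left_mono_neg) auto
    then have "\<mu> * (g z * (1 - g z) ^ (k + k)) \<le> \<mu> * (- \<delta>)"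
      using False \<mu> by (intro mult_left_mono) auto
    also have "\<dots> = - (C + 1)"
      using \<delta> by (simp add: \<mu>_def)
    finally show ?thesis
      using C(2)[OF z] by (simp add: power_add)
  qed
  then show ?thesis using \<mu> by (intro exI[of _ \<mu>]) auto
qed

text \<open>
  On the compact set where \<open>\<psi> \<le> 0\<close> the parameter is positive, hence bounded away from zero.
\<close>

lemma pos_for_small_parameter:
  fixes \<psi> :: "'a::t2_space \<times> real \<Rightarrow> real"
  assumes X: "compact X" and cont: "continuous_on (X \<times> {0..1}) \<psi>"
    and pos: "\<And>z. z \<in> X \<Longrightarrow> 0 < \<psi> (z, 0)"
  shows "\<exists>\<eta>>0. \<forall>z\<in>X. \<forall>h\<in>{0..<\<eta>}. 0 < \<psi> (z, h)"
proof -
  let ?B = "{w \<in> X \<times> {0..1}. \<psi> w \<le> 0}"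
  have "\<exists>\<eta>>0. \<forall>w\<in>?B. \<eta> \<le> snd w"
  proof (intro pos_on_compact_bounded_below)
    show "compact ?B"
      using X cont by (intro compact_sublevel compact_Times) auto
    show "0 < snd w" if "w \<in> ?B" for w
      using that pos[of "fst w"] by (cases w, cases "snd w = 0") auto
  qed (intro continuous_intros)
  then obtain \<eta> where "0 < \<eta>" "\<And>w. w \<in> ?B \<Longrightarrow> \<eta> \<le> snd w" by blast
  then show ?thesis
    by (intro exI[of _ "min \<eta> 1"]) force
qed

section \<open>Matrix modules over the affine functions nonnegative on a convex set\<close>

definition affine_rpoly :: "real \<Rightarrow> real^'d \<Rightarrow> 'd::finite rpoly"
  where "affine_rpoly c a = pconst c + (\<Sum>i\<in>UNIV. pconst (a $ i) * pvar i)"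

lemma peval_affine_rpoly: "peval (affine_rpoly c a) x = c + a \<bullet> x"
  by (simp add: affine_rpoly_def peval_simps inner_vec_def)

lemma quadratic_form_scaleR:
  fixes B :: "real^'n^'n"
  shows "(s *\<^sub>R v) \<bullet> (B *v (s *\<^sub>R v)) = s\<^sup>2 * (v \<bullet> (B *v v))"
  by (simp add: matrix_vector_mult_scaleR power2_eq_square)

lemma continuous_on_quadratic_form [continuous_intros]:
  fixes F :: "'d::finite rpoly^'l^'l"
  assumes "continuous_on S f" "continuous_on S g"
  shows "continuous_on S (\<lambda>z. g z \<bullet> (mat_peval F (f z) *v g z))"
  unfolding quadratic_form_sum mat_peval_def vec_lambda_beta using assms
  by (intro continuous_intros)

lemma quadratic_form_diff_mat:
  "v \<bullet> (mat_peval (F - mat p) x *v v) = v \<bullet> (mat_peval F x *v v) - peval p x * (v \<bullet> v)"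
proof -
  have "mat_peval (F - mat p) x = mat_peval F x - peval p x *\<^sub>R mat 1"
    by (simp add: vec_eq_iff mat_peval_def mat_def peval_diff peval_zero)
  then show ?thesis
    by (simp add: matrix_vector_mult_diff_rdistrib inner_diff_right flip: scaleR_matrix_vector_assoc)
qed

text \<open>
  The pencil enters the Positivstellensatz only through these properties of its quadratic module and its projected
  spectrahedron.
\<close>

locale affine_matrix_module =
  fixes Q :: "('d::finite rpoly^'l^'l) set" and K :: "(real^'d) set"
  assumes zero_mem: "0 \<in> Q"
    and add_mem: "F \<in> Q \<Longrightarrow> G \<in> Q \<Longrightarrow> F + G \<in> Q"
    and affine_rank_one_mem:
      "(\<And>x. x \<in> K \<Longrightarrow> 0 \<le> c + a \<bullet> x) \<Longrightarrow> (\<chi> i j. affine_rpoly c a * w i * w j) \<in> Q"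
    and convex: "convex K"
    and bounded: "bounded K"
begin

text \<open>
  Asking for all \<open>w w^T\<close> instead of the identity matrix makes this set closed under multiplication by squares, and it
  allows the positive semidefinite coefficients of a Bernstein expansion to be attached to multipliers.
\<close>

definition multipliers :: "'d rpoly set"
  where "multipliers = {p. \<forall>w. (\<chi> i j. p * w i * w j) \<in> Q}"

lemma sum_mem: "(\<And>a. a \<in> I \<Longrightarrow> f a \<in> Q) \<Longrightarrow> (\<Sum>a\<in>I. f a) \<in> Q"
  by (induction I rule: infinite_finite_induct) (auto simp: zero_mem add_mem)

lemma multipliers_add:
  assumes "p \<in> multipliers" "q \<in> multipliers"
  shows "p + q \<in> multipliers"
proof -
  have eq: "(\<chi> i j. (p + q) * w i * w j) = (\<chi> i j. p * w i * w j) + (\<chi> i j. q * w i * w j)"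
    for w :: "'l \<Rightarrow> 'd rpoly"
    by (simp add: vec_eq_iff distrib_right)
  show ?thesis
    using assms unfolding multipliers_def mem_Collect_eq eq by (blast intro: add_mem)
qed

text \<open>
  The factor \<open>q^2\<close> is absorbed by replacing \<open>w\<close> with \<open>q w\<close>.
\<close>

lemma multipliers_mult_square:
  assumes "p \<in> multipliers"
  shows "p * (q * q) \<in> multipliers"
proof -
  have "(\<chi> i j. p * (q * w i) * (q * w j)) \<in> Q" for w
    using assms unfolding multipliers_def mem_Collect_eq by (rule spec[where x = "\<lambda>i. q * w i"])
  then show ?thesis
    by (simp add: multipliers_def mult_ac)
qed

lemma affine_mem_multipliers:
  "(\<And>x. x \<in> K \<Longrightarrow> 0 \<le> c + a \<bullet> x) \<Longrightarrow> affine_rpoly c a \<in> multipliers"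
  by (simp add: multipliers_def affine_rank_one_mem)

lemma pconst_mem_multipliers: "0 \<le> c \<Longrightarrow> pconst c \<in> multipliers"
  using affine_mem_multipliers[of c 0] by (simp add: affine_rpoly_def pconst_simps)

lemma multipliers_sum: "(\<And>a. a \<in> I \<Longrightarrow> f a \<in> multipliers) \<Longrightarrow> (\<Sum>a\<in>I. f a) \<in> multipliers"
  using pconst_mem_multipliers[of 0]
  by (induction I rule: infinite_finite_induct) (auto simp: pconst_simps multipliers_add)

lemma square_mem_multipliers: "q * q \<in> multipliers"
  using multipliers_mult_square[OF pconst_mem_multipliers[of 1]] by (simp add: pconst_simps)

lemma multipliers_scale: "p \<in> multipliers \<Longrightarrow> 0 \<le> c \<Longrightarrow> pconst c * p \<in> multipliers"
  using multipliers_mult_square[of p "pconst (sqrt c)"]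
  by (simp add: mult.commute flip: pconst_simps(3))

lemma pos_semidef_times_multiplier_mem:
  assumes "p \<in> multipliers" "pos_semidef B"
  shows "(\<chi> a b. pconst (B $ a $ b) * p) \<in> Q"
proof -
  obtain r :: nat and u where u: "\<And>a b. B $ a $ b = (\<Sum>c<r. u c a * u c b)"
    using pos_semidef_sum_rank_one[OF assms(2)] by blast
  have "(\<chi> a b. pconst (B $ a $ b) * p) = (\<Sum>c<r. \<chi> a b. p * pconst (u c a) * pconst (u c b))"
    by (simp add: vec_eq_iff u sum_component pconst_sum pconst_simps sum_distrib_left sum_distrib_right mult_ac)
  also have "\<dots> \<in> Q"
    using assms(1) by (intro sum_mem) (simp add: multipliers_def)
  finally show ?thesis .
qed

lemma mat_multiplier_mem:
  assumes "p \<in> multipliers"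
  shows "mat p \<in> Q"
proof -
  have "pos_semidef (mat 1 :: real^'l^'l)"
    unfolding pos_semidef_def sym_mat_iff by (simp, simp add: mat_def)
  moreover have "mat p = (\<chi> a b. pconst ((mat 1 :: real^'l^'l) $ a $ b) * p)"
    by (simp add: vec_eq_iff mat_def pconst_simps)
  ultimately show ?thesis
    using pos_semidef_times_multiplier_mem[OF assms] by metis
qed

text \<open>
  \<open>n + x\<close> and \<open>n - x\<close> are multipliers, and
  \<open>(n + x) (n - x)^2 + (n - x) (n + x)^2 = 2 n (n^2 - x^2)\<close>.
\<close>

lemma ball_multiplier:
  "\<exists>N::nat. 0 < N \<and> of_nat N - (\<Sum>i\<in>UNIV. pvar i * pvar i) \<in> multipliers"
proof -
  obtain b where b: "\<And>x. x \<in> K \<Longrightarrow> norm x \<le> b"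
    using bounded by (auto simp: bounded_iff)
  obtain n :: nat where n: "max b 1 < real n"
    using reals_Archimedean2 by blast
  let ?n = "of_nat n :: 'd rpoly"
  have n_pos: "0 < n" using n by (cases n) auto
  have coord: "?n + pvar i \<in> multipliers" "?n - pvar i \<in> multipliers" for i
  proof -
    have le: "\<bar>x $ i\<bar> \<le> real n" if "x \<in> K" for x
      using component_le_norm_cart[of x i] b[OF that] n by linarith
    have "affine_rpoly (real n) (axis i s) = ?n + pconst s * pvar i" for s
      by (simp add: affine_rpoly_def pconst_of_nat axis_def if_distrib[of pconst]
          if_distrib[of "\<lambda>t. t * _"] pconst_simps cong: if_cong)
    moreover have "affine_rpoly (real n) (axis i s) \<in> multipliers" if "s = 1 \<or> s = -1" for s
    proof (intro affine_mem_multipliers)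
      fix x assume "x \<in> K"
      from le[OF this] that show "0 \<le> real n + axis i s \<bullet> x"
        by (auto simp: inner_axis')
    qed
    ultimately show "?n + pvar i \<in> multipliers" "?n - pvar i \<in> multipliers"
      by (metis pconst_simps(5) mult_1, metis pconst_simps(5,6) mult_minus1 diff_conv_add_uminus)
  qed
  have "of_nat (n * n) - pvar i * pvar i \<in> multipliers" for i
  proof -
    let ?x = "pvar i :: 'd rpoly"
    have c: "pconst (1 / (2 * real n)) * (2 * ?n) = 1"
    proof -
      have "2 * ?n = pconst (2 * real n)"
        by (metis of_nat_mult of_nat_numeral pconst_of_nat)
      then show ?thesis
        using n_pos by (simp flip: pconst_simps(3)) (simp add: pconst_simps)
    qed
    have "(?n + ?x) * ((?n - ?x) * (?n - ?x)) + (?n - ?x) * ((?n + ?x) * (?n + ?x))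
        = 2 * ?n * (of_nat (n * n) - ?x * ?x)"
      by (simp add: algebra_simps)
    then have "pconst (1 / (2 * real n)) *
        ((?n + ?x) * ((?n - ?x) * (?n - ?x)) + (?n - ?x) * ((?n + ?x) * (?n + ?x)))
        = pconst (1 / (2 * real n)) * (2 * ?n) * (of_nat (n * n) - ?x * ?x)"
      by (simp only: mult.assoc)
    then have "of_nat (n * n) - ?x * ?x = pconst (1 / (2 * real n)) *
        ((?n + ?x) * ((?n - ?x) * (?n - ?x)) + (?n - ?x) * ((?n + ?x) * (?n + ?x)))"
      by (simp only: c mult_1)
    also have "\<dots> \<in> multipliers"
      by (intro multipliers_scale multipliers_add multipliers_mult_square coord) simp
    finally show ?thesis .
  qed
  then have "(\<Sum>i\<in>UNIV. of_nat (n * n) - pvar i * pvar i) \<in> multipliers"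
    by (intro multipliers_sum)
  moreover have "(\<Sum>i\<in>(UNIV :: 'd set). of_nat (n * n) - pvar i * pvar i)
      = (of_nat (CARD('d) * (n * n)) - (\<Sum>i\<in>UNIV. pvar i * pvar i) :: 'd rpoly)"
    by (simp add: sum_subtractf)
  ultimately show ?thesis
    using n_pos by (intro exI[of _ "CARD('d) * (n * n)"]) auto
qed

lemma archimedean_module: "archimedean Q"
  using ball_multiplier mat_multiplier_mem unfolding archimedean_def by blast

text \<open>
  A quadratic module need not be closed under products, but the part generated by squares and the single element
  \<open>g\<close> is. Let \<open>T\<close> be the set of multipliers \<open>t\<close> for which \<open>t g\<close> is a multiplier too, and \<open>M\<close> the set of polynomials
  that map \<open>T\<close> into itself by multiplication. Then \<open>M\<close> is closed under sums and products, contains the squares and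
  \<open>g\<close>, and consists of multipliers because \<open>1 \<in> T\<close>. With \<open>g = C - x^T x\<close> and \<open>R = C\<close>,
  \<open>2 R (R + x_i) = (R + x_i)^2 + (R^2 - C) + g + (\<Sum>j\<noteq>i. x_j^2)\<close>, so \<open>R \<plusminus> x_i \<in> M\<close>.
\<close>

lemma bern_basis_multiplier:
  "\<exists>R>0. \<forall>N J. bern_basis R N J \<in> multipliers"
proof -
  obtain C :: nat where C: "0 < C" "of_nat C - (\<Sum>i\<in>UNIV. pvar i * pvar i) \<in> multipliers"
    using ball_multiplier by blast
  define g :: "'d rpoly" where "g = of_nat C - (\<Sum>i\<in>UNIV. pvar i * pvar i)"
  have g: "g \<in> multipliers" using C(2) by (simp add: g_def)
  define T where "T = {t \<in> multipliers. t * g \<in> multipliers}"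
  define M where "M = {p. \<forall>t\<in>T. p * t \<in> T}"
  have "1 \<in> T"
    using g square_mem_multipliers[of 1] by (simp add: T_def)
  then have M_sub: "p \<in> multipliers" if "p \<in> M" for p
    using that by (force simp: M_def T_def)
  have M_add: "p + q \<in> M" if "p \<in> M" "q \<in> M" for p q
    using that multipliers_add by (auto simp: M_def T_def distrib_right)
  have M_mult: "p * q \<in> M" if "p \<in> M" "q \<in> M" for p q
    using that by (auto simp: M_def mult.assoc)
  have M_square: "q * q \<in> M" for q
  proof -
    have "q * q * t \<in> T" if "t \<in> T" for t
      using that multipliers_mult_square[of t q] multipliers_mult_square[of "t * g" q]
      by (simp add: T_def mult_ac)
    then show ?thesis by (simp add: M_def)
  qed
  have M_g: "g \<in> M"
  proof -
    have "g * t \<in> T" if "t \<in> T" for t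
      using that multipliers_mult_square[of t g] by (simp add: T_def mult_ac)
    then show ?thesis by (simp add: M_def)
  qed
  have M_pconst: "pconst c \<in> M" if "0 \<le> c" for c
    using M_square[of "pconst (sqrt c)"] that by (simp flip: pconst_simps(3))
  have M_sum: "(\<Sum>a\<in>I. f a) \<in> M" if "\<And>a. a \<in> I \<Longrightarrow> f a \<in> M" for I :: "'d set" and f
    using that M_pconst[of 0]
    by (induction I rule: infinite_finite_induct) (auto simp: pconst_simps M_add)
  have M_one: "1 \<in> M" using M_square[of 1] by simp
  have M_prod: "(\<Prod>a\<in>I. f a) \<in> M" if "\<And>a. a \<in> I \<Longrightarrow> f a \<in> M" for I :: "'d set" and f
    using that M_one by (induction I rule: infinite_finite_induct) (auto simp: M_mult)
  have M_power: "p ^ k \<in> M" if "p \<in> M" for p k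
    using that M_one by (induction k) (auto simp: M_mult)
  define R where "R = real C"
  have R: "1 \<le> R" using C(1) by (simp add: R_def)
  have linear: "pconst R + y \<in> M" if "y = pvar i \<or> y = - pvar i" for y i
  proof -
    have y: "y * y = pvar i * pvar i" using that by auto
    have "(\<Sum>j\<in>UNIV. pvar j * pvar j) = y * y + (\<Sum>j\<in>UNIV - {i}. pvar j * pvar j)"
      unfolding y by (simp add: sum.remove)
    then have double: "2 * pconst R * (pconst R + y) = (pconst R + y) * (pconst R + y) +
        pconst (R * R - R) + g + (\<Sum>j\<in>UNIV - {i}. pvar j * pvar j)"
      by (simp add: g_def R_def pconst_of_nat[symmetric] pconst_simps algebra_simps)
    have half: "pconst (1 / (2 * R)) * (2 * pconst R) = (1 :: 'd rpoly)"
    proof -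
      have "2 * pconst R = (pconst (2 * R) :: 'd rpoly)"
        by (simp only: mult_2 pconst_simps(1))
      then show ?thesis using R by (simp flip: pconst_simps(3)) (simp add: pconst_simps)
    qed
    have "pconst (1 / (2 * R)) * (2 * pconst R * (pconst R + y))
        = pconst (1 / (2 * R)) * (2 * pconst R) * (pconst R + y)"
      by (simp only: mult.assoc)
    then have eq: "pconst R + y = pconst (1 / (2 * R)) * ((pconst R + y) * (pconst R + y) +
        pconst (R * R - R) + g + (\<Sum>j\<in>UNIV - {i}. pvar j * pvar j))"
      unfolding double half by (simp only: mult_1)
    have "0 \<le> R * R - R" using R by simp
    then show ?thesis
      using R by (subst eq) (intro M_mult M_add M_sum M_square M_g M_pconst; simp)
  qed
  have "bern_basis R N J \<in> M" for N J
    unfolding bern_basis_def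
    using R linear[of "pvar _"] linear[of "- pvar _"]
    by (intro M_prod M_mult M_power M_pconst) auto
  then show ?thesis
    using R M_sub by (intro exI[of _ R]) auto
qed

text \<open>
  At \<open>h = 0\<close> the matrix of Bernstein coefficients is a value of \<open>F\<close> on the cube, hence positive definite.
  By continuity and compactness it remains so for small \<open>h = 1 / N\<close>, at all grid points at once.
\<close>

lemma mem_if_pos_on_cube:
  assumes R: "0 < R" and basis: "\<And>N J. bern_basis R N J \<in> multipliers"
    and sym: "sym_mat F"
    and pos: "\<And>x v. x \<in> cbox (\<chi> i. - R) (\<chi> i. R) \<Longrightarrow> norm v = 1 \<Longrightarrow>
      0 < v \<bullet> (mat_peval F x *v v)"
  shows "F \<in> Q"
proof -
  define B where "B \<tau> h = (\<chi> a b. bern_coeff R (F $ a $ b) \<tau> h)" for \<tau> h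
  let ?X = "cbox (0 :: real^'d) (\<chi> i. 1) \<times> sphere (0 :: real^'l) 1"
  let ?\<psi> = "\<lambda>((\<tau>, v), h). v \<bullet> (B \<tau> h *v v)"
  have "\<exists>\<eta>>0. \<forall>z\<in>?X. \<forall>h\<in>{0..<\<eta>}. 0 < ?\<psi> (z, h)"
  proof (rule pos_for_small_parameter)
    show "compact ?X" by (intro compact_Times compact_cbox compact_sphere)
    show "continuous_on (?X \<times> {0..1}) ?\<psi>"
      unfolding case_prod_beta quadratic_form_sum B_def vec_lambda_beta
      by (intro continuous_intros)
    fix z assume "z \<in> ?X"
    then obtain \<tau> v where z: "z = (\<tau>, v)" "\<And>i. 0 \<le> \<tau> $ i" "\<And>i. \<tau> $ i \<le> 1" "norm v = 1"
      by (auto simp: mem_box_cart)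
    let ?x = "\<chi> i. 2 * R * \<tau> $ i - R"
    have "B \<tau> 0 = mat_peval F ?x"
      by (simp add: B_def mat_peval_def bern_coeff_at_0)
    moreover have "?x \<in> cbox (\<chi> i. - R) (\<chi> i. R)"
      using z(2,3) R by (auto simp: mem_box_cart)
    ultimately show "0 < ?\<psi> (z, 0)"
      using pos z by simp
  qed
  then obtain \<eta> where \<eta>: "0 < \<eta>"
    "\<And>\<tau> v h. \<tau> \<in> cbox 0 (\<chi> i. 1) \<Longrightarrow> norm v = 1 \<Longrightarrow> h \<in> {0..<\<eta>} \<Longrightarrow> 0 < v \<bullet> (B \<tau> h *v v)"
    by force
  let ?E = "\<Union>a\<in>UNIV. \<Union>b\<in>UNIV. \<Union>i\<in>UNIV.
    (\<lambda>e. Poly_Mapping.lookup e i) ` Poly_Mapping.keys (F $ a $ b)"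
  have "finite ?E" by auto
  then obtain D where D: "\<And>k. k \<in> ?E \<Longrightarrow> k \<le> D"
    using finite_nat_set_iff_bounded_le by meson
  obtain n :: nat where n: "1 / \<eta> < real n"
    using reals_Archimedean2 by blast
  define N where "N = Suc (max n (2 * D))"
  have N: "0 < N" "n < N" "2 * D \<le> N" by (auto simp: N_def)
  have "1 / \<eta> < real N" using n N(2) by linarith
  then have h: "1 / real N \<in> {0..<\<eta>}"
    using \<eta>(1) N(1) by (simp add: field_simps)
  have psd: "pos_semidef (B (\<chi> i. real (J i) / real N) (1 / real N))"
    if "J \<in> (UNIV :: 'd set) \<rightarrow>\<^sub>E {..N}" for J
  proof -
    let ?\<tau> = "(\<chi> i. real (J i) / real N) :: real^'d"
    let ?B = "B ?\<tau> (1 / real N)"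
    have "J i \<le> N" for i using that by (auto simp: PiE_def Pi_def)
    then have \<tau>: "?\<tau> \<in> cbox 0 (\<chi> i. 1)"
      using N(1) by (auto simp: mem_box_cart)
    have "0 \<le> v \<bullet> (?B *v v)" for v
    proof (cases "v = 0")
      case False
      \<comment> \<open>the positivity obtained above is for unit vectors\<close>
      let ?u = "(1 / norm v) *\<^sub>R v"
      have "v \<bullet> (?B *v v) = (norm v)\<^sup>2 * (?u \<bullet> (?B *v ?u))"
        using False quadratic_form_scaleR[of "norm v" ?u ?B] by simp
      also have "\<dots> \<ge> 0"
        using False by (intro mult_nonneg_nonneg less_imp_le[OF \<eta>(2)] \<tau> h) auto
      finally show ?thesis .
    qed simp
    then show ?thesis
      using sym by (auto simp: pos_semidef_def sym_mat_iff B_def)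
  qed
  have "F = (\<Sum>J\<in>(UNIV :: 'd set) \<rightarrow>\<^sub>E {..N}. \<chi> a b.
      pconst (B (\<chi> i. real (J i) / real N) (1 / real N) $ a $ b) * bern_basis R N J)"
  proof -
    have deg: "2 * Poly_Mapping.lookup e i \<le> N" if "e \<in> Poly_Mapping.keys (F $ a $ b)" for e i a b
    proof -
      have "Poly_Mapping.lookup e i \<in> ?E" using that by blast
      then show ?thesis using D N(3) by fastforce
    qed
    show ?thesis
      using Bernstein_expansion[OF R N(1) deg] by (simp add: vec_eq_iff sum_component B_def)
  qed
  also have "\<dots> \<in> Q"
    by (intro sum_mem pos_semidef_times_multiplier_mem basis psd)
  finally show ?thesis .
qed

text \<open>
  Induction on the number of constraints. Penalizing one of them makes positivity hold on the part of the cube cut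
  out by the others, and the penalty term is itself in the module.
\<close>

lemma mem_if_pos_on_polyhedron:
  assumes R: "0 < R" and basis: "\<And>N J. bern_basis R N J \<in> multipliers"
    and "finite H"
    and "\<And>c a x. (c, a) \<in> H \<Longrightarrow> x \<in> K \<Longrightarrow> 0 \<le> c + a \<bullet> x"
    and "\<And>c a x. (c, a) \<in> H \<Longrightarrow> x \<in> cbox (\<chi> i. - R) (\<chi> i. R) \<Longrightarrow> c + a \<bullet> x \<le> 1"
    and "sym_mat F"
    and "\<And>x v. x \<in> cbox (\<chi> i. - R) (\<chi> i. R) \<Longrightarrow> norm v = 1 \<Longrightarrow>
      (\<And>c a. (c, a) \<in> H \<Longrightarrow> 0 \<le> c + a \<bullet> x) \<Longrightarrow> 0 < v \<bullet> (mat_peval F x *v v)"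
  shows "F \<in> Q"
  using assms(3-)
proof (induction H arbitrary: F rule: finite_induct)
  case empty
  then show ?case by (intro mem_if_pos_on_cube[OF R basis]) auto
next
  case (insert ca H)
  obtain c a where ca: "ca = (c, a)" by (cases ca)
  let ?C = "cbox (\<chi> i. - R) (\<chi> i. R) :: (real^'d) set"
  let ?Y = "?C \<inter> (\<Inter>(c, a)\<in>H. {x. 0 \<le> c + a \<bullet> x})"
  let ?\<phi> = "\<lambda>z :: (real^'d) \<times> (real^'l). snd z \<bullet> (mat_peval F (fst z) *v snd z)"
  let ?g = "\<lambda>z :: (real^'d) \<times> (real^'l). c + a \<bullet> fst z"
  have "\<exists>\<mu>\<ge>0. \<exists>k. \<forall>z\<in>?Y \<times> sphere 0 1.
      0 < ?\<phi> z - \<mu> * (?g z * ((1 - ?g z) ^ k * (1 - ?g z) ^ k))"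
  proof (rule penalty_makes_positive)
    have "closed {x. 0 \<le> c + a \<bullet> x}" for c and a :: "real^'d"
      by (intro closed_Collect_le continuous_intros)
    then show "compact (?Y \<times> sphere (0 :: real^'l) 1)"
      by (intro compact_Times compact_Int_closed compact_cbox compact_sphere closed_INT) auto
    show "?g z \<le> 1" if "z \<in> ?Y \<times> sphere 0 1" for z
      using that insert.prems(2)[of c a "fst z"] by (auto simp: ca)
    show "0 < ?\<phi> z" if "z \<in> ?Y \<times> sphere 0 1" "0 \<le> ?g z" for z
      using that by (intro insert.prems(4)) (auto simp: ca)
  qed (intro continuous_intros)+
  then obtain \<mu> k where \<mu>: "0 \<le> \<mu>"
    and pos: "\<And>x v. x \<in> ?Y \<Longrightarrow> norm v = 1 \<Longrightarrow> 0 < v \<bullet> (mat_peval F x *v v) -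
      \<mu> * ((c + a \<bullet> x) * ((1 - (c + a \<bullet> x)) ^ k * (1 - (c + a \<bullet> x)) ^ k))"
    by fastforce
  let ?q = "affine_rpoly c a"
  define p where "p = pconst \<mu> * (?q * ((1 - ?q) ^ k * (1 - ?q) ^ k))"
  have p: "p \<in> multipliers"
    unfolding p_def using insert.prems(1)[of c a] \<mu>
    by (intro multipliers_scale multipliers_mult_square affine_mem_multipliers) (auto simp: ca)
  have "F - mat p \<in> Q"
  proof (rule insert.IH)
    show "sym_mat (F - mat p)"
      using insert.prems(3) by (auto simp: sym_mat_iff mat_def)
    fix x :: "real^'d" and v :: "real^'l"
    assume "x \<in> ?C" "norm v = 1" "\<And>c a. (c, a) \<in> H \<Longrightarrow> 0 \<le> c + a \<bullet> x"
    then show "0 < v \<bullet> (mat_peval (F - mat p) x *v v)"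
      using pos[of x v]
      by (auto simp: quadratic_form_diff_mat p_def peval_simps peval_affine_rpoly
          dot_square_norm)
  qed (use insert.prems(1,2) in auto)
  from add_mem[OF this mat_multiplier_mem[OF p]] show ?case by simp
qed

text \<open>
  A point of the cube where \<open>F\<close> is not positive definite lies outside the closed convex set \<open>closure K\<close>, so some
  affine function that is nonnegative on \<open>K\<close> is negative there. Finitely many of them suffice by compactness of the
  set \<open>Z\<close> of bad pairs of a point and a unit vector.
\<close>

theorem pos_def_on_closure_mem:
  assumes sym: "sym_mat F" and pos: "\<And>x. x \<in> closure K \<Longrightarrow> pos_def (mat_peval F x)"
  shows "F \<in> Q"
proof -
  obtain R where R: "0 < R" "\<And>N J. bern_basis R N J \<in> multipliers"
    using bern_basis_multiplier by blast
  let ?C = "cbox (\<chi> i. - R) (\<chi> i. R) :: (real^'d) set"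
  let ?\<phi> = "\<lambda>z :: (real^'d) \<times> (real^'l). snd z \<bullet> (mat_peval F (fst z) *v snd z)"
  define Z where "Z = {z \<in> ?C \<times> sphere 0 1. ?\<phi> z \<le> 0}"
  define H where "H = {(c, a). (\<forall>x\<in>K. 0 \<le> c + a \<bullet> x) \<and> (\<forall>x\<in>?C. c + a \<bullet> x \<le> 1)}"
  have "compact Z"
    unfolding Z_def
    by (intro compact_sublevel compact_Times compact_cbox compact_sphere continuous_intros)
  moreover have "open {z :: (real^'d) \<times> (real^'l). fst ca + snd ca \<bullet> fst z < 0}" for ca
    by (intro open_Collect_less continuous_intros)
  moreover have "Z \<subseteq> (\<Union>ca\<in>H. {z. fst ca + snd ca \<bullet> fst z < 0})"
  proof
    fix z assume z: "z \<in> Z"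
    then have "?\<phi> z \<le> 0" "snd z \<noteq> 0"
      by (auto simp: Z_def)
    then have "fst z \<notin> closure K"
      using pos[of "fst z"] by (fastforce simp: pos_def_def)
    then obtain a b where ab: "a \<bullet> fst z < b" "\<And>x. x \<in> closure K \<Longrightarrow> b < a \<bullet> x"
      using separating_hyperplane_closed_point[of "closure K" "fst z"] convex
      by (auto simp: convex_closure)
    have "bounded ((\<lambda>x. a \<bullet> x - b) ` ?C)"
      by (intro compact_imp_bounded compact_continuous_image continuous_intros compact_cbox)
    then obtain s where s: "0 < s" "\<And>x. x \<in> ?C \<Longrightarrow> \<bar>a \<bullet> x - b\<bar> \<le> s"
      by (auto simp: bounded_pos)
    \<comment> \<open>dividing by \<open>s\<close> makes the function at most \<open>1\<close> on the cube\<close>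
    have scaled: "- b / s + (a /\<^sub>R s) \<bullet> x = (a \<bullet> x - b) / s" for x
      using s(1) by (simp add: field_simps)
    have "(- b / s, a /\<^sub>R s) \<in> H"
      unfolding H_def mem_Collect_eq split scaled
    proof (intro conjI ballI)
      fix x assume "x \<in> K"
      then show "0 \<le> (a \<bullet> x - b) / s"
        using ab(2)[of x] closure_subset s(1) by fastforce
    next
      fix x assume "x \<in> ?C"
      then show "(a \<bullet> x - b) / s \<le> 1"
        using s by (force simp: divide_le_eq_1)
    qed
    moreover have "- b / s + (a /\<^sub>R s) \<bullet> fst z < 0"
      unfolding scaled using ab(1) s(1) by (simp add: divide_neg_pos)
    ultimately show "z \<in> (\<Union>ca\<in>H. {z. fst ca + snd ca \<bullet> fst z < 0})"
      by force
  qed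
  ultimately obtain H' where H': "H' \<subseteq> H" "finite H'"
    "Z \<subseteq> (\<Union>ca\<in>H'. {z. fst ca + snd ca \<bullet> fst z < 0})"
    by (rule compactE_image)
  show ?thesis
  proof (rule mem_if_pos_on_polyhedron[OF R H'(2) _ _ sym])
    fix x :: "real^'d" and v :: "real^'l"
    assume x: "x \<in> ?C" "norm v = 1" and H'x: "\<And>c a. (c, a) \<in> H' \<Longrightarrow> 0 \<le> c + a \<bullet> x"
    have "(x, v) \<notin> Z"
    proof
      assume "(x, v) \<in> Z"
      then obtain c a where "(c, a) \<in> H'" "c + a \<bullet> x < 0"
        using H'(3) by force
      with H'x show False by fastforce
    qed
    then show "0 < v \<bullet> (mat_peval F x *v v)"
      using x by (auto simp: Z_def)
  qed (use H'(1) in \<open>auto simp: H_def\<close>)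
qed

end

section \<open>The quadratic module of a projected spectrahedron\<close>

lemma sos_mats_iff:
  "S \<in> sos_mats \<longleftrightarrow> (\<exists>(r::nat) U. \<forall>a b. S $ a $ b = (\<Sum>c<r. U a c * U b c))"
  by (simp add: sos_mats_def vec_eq_iff)

lemma sos_mats_add:
  assumes "S \<in> sos_mats" "T \<in> sos_mats"
  shows "S + T \<in> sos_mats"
proof -
  obtain r :: nat and U where S: "\<And>a b. S $ a $ b = (\<Sum>c<r. U a c * U b c)"
    using assms(1) unfolding sos_mats_iff by blast
  obtain s :: nat and V where T: "\<And>a b. T $ a $ b = (\<Sum>c<s. V a c * V b c)"
    using assms(2) unfolding sos_mats_iff by blast
  define W where "W a c = (if c < r then U a c else V a (c - r))" for a c
  have "(\<Sum>c<r + s. W a c * W b c) = (\<Sum>c<r. U a c * U b c) + (\<Sum>c<s. V a c * V b c)" for a b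
  proof -
    have "(\<Sum>c<r + s. W a c * W b c) = (\<Sum>c<r. W a c * W b c) + (\<Sum>c=r..<r + s. W a c * W b c)"
      by (simp add: lessThan_atLeast0 sum.atLeastLessThan_concat)
    also have "(\<Sum>c=r..<r + s. W a c * W b c) = (\<Sum>c<s. V a c * V b c)"
      by (rule sum.reindex_bij_witness[of _ "\<lambda>c. c + r" "\<lambda>c. c - r"]) (auto simp: W_def)
    also have "(\<Sum>c<r. W a c * W b c) = (\<Sum>c<r. U a c * U b c)"
      by (simp add: W_def)
    finally show ?thesis .
  qed
  then have "\<forall>a b. (S + T) $ a $ b = (\<Sum>c<r + s. W a c * W b c)"
    by (simp add: S T)
  then show ?thesis unfolding sos_mats_iff by blast
qed

lemma zero_mem_sos_mats: "0 \<in> sos_mats"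
  unfolding sos_mats_iff by (intro exI[of _ 0]) simp

lemma block_inner_add: "block_inner (S + T) N = block_inner S N + block_inner T N"
  by (simp add: vec_eq_iff block_inner_def trace_inner_def block_def distrib_right sum.distrib)

lemma block_inner_zero: "block_inner 0 N = 0"
  by (simp add: vec_eq_iff block_inner_def trace_inner_def block_def)

lemma zero_mem_quad_module: "0 \<in> quad_module m A0 A A'"
  unfolding quad_module_def
  by (rule CollectI, intro exI[of _ 0] conjI) (simp_all add: block_inner_zero zero_mem_sos_mats)

lemma add_mem_quad_module:
  assumes "F \<in> quad_module m A0 A A'" "G \<in> quad_module m A0 A A'"
  shows "F + G \<in> quad_module m A0 A A'"
proof -
  obtain S0 S where F: "F = S0 + block_inner S (pencil_x0 A0 A)"
    "\<forall>j\<in>{1..m}. block_inner S (mat_pconst (A' j)) = 0" "S0 \<in> sos_mats" "S \<in> sos_mats"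
    using assms(1) by (auto simp: quad_module_def)
  obtain T0 T where G: "G = T0 + block_inner T (pencil_x0 A0 A)"
    "\<forall>j\<in>{1..m}. block_inner T (mat_pconst (A' j)) = 0" "T0 \<in> sos_mats" "T \<in> sos_mats"
    using assms(2) by (auto simp: quad_module_def)
  show ?thesis
    unfolding quad_module_def
    by (rule CollectI, rule exI[of _ "S0 + T0"], rule exI[of _ "S + T"])
       (use F G in \<open>simp add: block_inner_add sos_mats_add algebra_simps\<close>)
qed

text \<open>
  The Kronecker product \<open>w w^T \<otimes> S\<close>: its block with indices \<open>i\<close>, \<open>j\<close> is \<open>w_i w_j S\<close>.
\<close>

definition kron :: "real^'k^'k \<Rightarrow> ('l \<Rightarrow> 'd rpoly) \<Rightarrow> 'd rpoly^('l::finite \<times> 'k::finite)^('l \<times> 'k)"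
  where "kron S w = (\<chi> p q. pconst (S $ snd p $ snd q) * w (fst p) * w (fst q))"

lemma kron_mem_sos_mats:
  assumes "pos_semidef S"
  shows "kron S w \<in> sos_mats"
proof -
  obtain r :: nat and u where u: "\<And>a b. S $ a $ b = (\<Sum>c<r. u c a * u c b)"
    using pos_semidef_sum_rank_one[OF assms] by blast
  define U where "U p c = pconst (u c (snd p)) * w (fst p)" for p c
  have "\<forall>p q. kron S w $ p $ q = (\<Sum>c<r. U p c * U q c)"
    by (simp add: kron_def u U_def pconst_sum pconst_simps sum_distrib_left mult_ac)
  then show ?thesis unfolding sos_mats_iff by blast
qed

lemma block_inner_kron:
  "block_inner (kron S w) N =
    (\<chi> i j. (\<Sum>a\<in>UNIV. \<Sum>b\<in>UNIV. pconst (S $ a $ b) * N $ a $ b) * w i * w j)"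
  by (simp add: vec_eq_iff block_inner_def trace_inner_def block_def kron_def
      sum_distrib_left mult_ac)

lemma trace_mat_pconst:
  "(\<Sum>a\<in>UNIV. \<Sum>b\<in>UNIV. pconst (S $ a $ b) * pconst (M $ a $ b)) = pconst (S \<bullet> M)"
  for S M :: "real^'k^'k"
  by (simp add: inner_vec_def pconst_sum pconst_simps)

lemma trace_pencil_x0:
  "(\<Sum>a\<in>UNIV. \<Sum>b\<in>UNIV. pconst (S $ a $ b) * pencil_x0 A0 A $ a $ b)
    = affine_rpoly (S \<bullet> A0) (\<chi> i. S \<bullet> A i)"
proof -
  have "(\<Sum>a\<in>UNIV. \<Sum>b\<in>UNIV. pconst (S $ a $ b) * pencil_x0 A0 A $ a $ b)
      = (\<Sum>a\<in>UNIV. \<Sum>b\<in>UNIV. pconst (S $ a $ b) * pconst (A0 $ a $ b))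
      + (\<Sum>a\<in>UNIV. \<Sum>b\<in>UNIV. \<Sum>i\<in>UNIV. pconst (S $ a $ b) * pconst (A i $ a $ b) * pvar i)"
    by (simp add: pencil_x0_def distrib_left sum.distrib sum_distrib_left mult_ac)
  also have "(\<Sum>a\<in>UNIV. \<Sum>b\<in>UNIV. \<Sum>i\<in>UNIV. pconst (S $ a $ b) * pconst (A i $ a $ b) * pvar i)
      = (\<Sum>i\<in>UNIV. \<Sum>a\<in>UNIV. \<Sum>b\<in>UNIV. pconst (S $ a $ b) * pconst (A i $ a $ b) * pvar i)"
    by (subst (2) sum.swap, subst sum.swap) simp
  also have "\<dots> = (\<Sum>i\<in>UNIV. pconst (S \<bullet> A i) * pvar i)"
    unfolding trace_mat_pconst[symmetric] sum_distrib_right ..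
  finally show ?thesis
    by (simp add: trace_mat_pconst affine_rpoly_def)
qed

lemma affine_rank_one_mem_quad_module:
  assumes "sym_mat A0" "\<And>i. sym_mat (A i)" "\<And>j. j \<in> {1..m} \<Longrightarrow> sym_mat (A' j)"
    and "strictly_feasible m A0 A A'"
    and "\<And>x. x \<in> proj_spectrahedron m A0 A A' \<Longrightarrow> 0 \<le> c + a \<bullet> x"
  shows "(\<chi> i j. affine_rpoly c a * w i * w j) \<in> quad_module m A0 A A'"
proof -
  obtain c0 S where c0: "0 \<le> c0" and S: "pos_semidef S" "\<And>j. j \<in> {1..m} \<Longrightarrow> S \<bullet> A' j = 0"
    and c: "c = c0 + S \<bullet> A0" and a: "\<And>i. a $ i = S \<bullet> A i"
    using nonneg_affine_certificate[OF assms] by blast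
  define V where "V i n = pconst (sqrt c0) * w i" for i and n :: nat
  define S0 where "S0 = (\<chi> i j. \<Sum>n<1. V i n * V j n)"
  have "S0 \<in> sos_mats"
    unfolding S0_def sos_mats_def by blast
  moreover have S0: "S0 = (\<chi> i j. pconst c0 * w i * w j)"
  proof -
    have "V i n * V j n = pconst (sqrt c0) * pconst (sqrt c0) * w i * w j" for i j n
      by (simp add: V_def mult_ac)
    then show ?thesis
      using c0 by (simp add: S0_def vec_eq_iff flip: pconst_simps(3))
  qed
  moreover have "affine_rpoly c a = pconst c0 + affine_rpoly (S \<bullet> A0) (\<chi> i. S \<bullet> A i)"
    by (simp add: affine_rpoly_def c a pconst_simps)
  then have "(\<chi> i j. affine_rpoly c a * w i * w j)
      = S0 + block_inner (kron S w) (pencil_x0 A0 A)"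
    by (simp add: block_inner_kron trace_pencil_x0 S0 vec_eq_iff distrib_right)
  moreover have "block_inner (kron S w) (mat_pconst (A' j)) = 0" if "j \<in> {1..m}" for j
    using S(2)[OF that]
    by (simp add: block_inner_kron mat_pconst_def trace_mat_pconst pconst_simps vec_eq_iff)
  ultimately show ?thesis
    unfolding quad_module_def using kron_mem_sos_mats[OF S(1)] by blast
qed

theorem theorem5p7:
  fixes m :: nat
    and A0 :: "real^'k^'k"
    and A :: "'d::finite \<Rightarrow> real^'k^'k"
    and A' :: "nat \<Rightarrow> real^'k^'k"
  assumes "sym_mat A0"
    and "\<And>i. sym_mat (A i)"
    and "\<And>j. j \<in> {1..m} \<Longrightarrow> sym_mat (A' j)"
    and "strictly_feasible m A0 A A'"
    and "bounded (proj_spectrahedron m A0 A A')"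
  shows "archimedean (quad_module m A0 A A' :: ('d rpoly^'l^'l) set) \<and>
    (\<forall>F :: 'd rpoly^'l^'l.
       sym_mat F \<and> (\<forall>x\<in>closure (proj_spectrahedron m A0 A A'). pos_def (mat_peval F x))
       \<longrightarrow> F \<in> quad_module m A0 A A')"
proof -
  interpret affine_matrix_module "quad_module m A0 A A' :: ('d rpoly^'l^'l) set"
      "proj_spectrahedron m A0 A A'"
    using assms
    by unfold_locales
       (auto intro: zero_mem_quad_module add_mem_quad_module affine_rank_one_mem_quad_module
         convex_proj_spectrahedron)
  show ?thesis
    using archimedean_module pos_def_on_closure_mem by blast
qed

end
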